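(* Let $\mathcal{H}$ be a separable quaternionic Hilbert space, let $J\in\mathcal{B}(\mathcal{H})$ be anti-selfadjoint and unitary, and let $i\in\mathbb{S}$. Suppose $T$ is a compact operator on $\mathcal{H}$ with $[T,J]=0$ and $2\le p<+\infty$. Then $T\in S_p(J)$ if and only if $$\sum_{n}\|Te_n\|^p<+\infty$$ for all orthonormal sets $\{e_n\}$ in $\mathcal{H}_+^{Ji}$. Moreover, $$\|T\|_p=\sup\left\{\Big[\sum_{n}\|Te_n\|^p\Big]^{\frac1p}:\{e_n\}\text{ orthonormal in }\mathcal{H}_+^{Ji}\right\}.$$
   Context: $\mathbb{H}$ denotes the quaternions, $\mathbb{S}=\{x\in\mathbb{H}:\operatorname{Re}(x)=0,\ |x|=1\}$ and $\mathbb{C}_i=\{a+ib:a,b\in\mathbb{R}\}$ for $i\in\mathbb{S}$. A quaternionic Hilbert space $\mathcal{H}$ is a right $\mathbb{H}$-vector space with a scalar product $\langle\cdot,\cdot\rangle:\mathcal{H}\times\mathcal{H}\to\mathbb{H}$ that is positive definite, right linear in the second argument, satisfies $\langle x,y\rangle=\overline{\langle y,x\rangle}$, and is complete for $\|x\|=\sqrt{\langle x,x\rangle}$. $\mathcal{B}(\mathcal{H})$ is the set of bounded right $\mathbb{H}$-linear operators, $\mathcal{B}_0(\mathcal{H})$ the set of compact ones. The adjoint is defined by $\langle T^*x,y\rangle=\langle x,Ty\rangle$; $J$ anti-selfadjoint and unitary means $J^*=-J$ and $J^*=J^{-1}$; $[T,J]=TJ-JT$. $\mathcal{H}_+^{Ji}=\{x\in\mathcal{H}:Jx=xi\}$,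 a complex Hilbert space over $\mathbb{C}_i$ with right scalar multiplication and the restricted scalar product. For $T\in\mathcal{B}_0(\mathcal{H})$ the singular values $(\lambda_n(T))_{n\in\mathbb{N}}$ are the eigenvalues of $|T|=\sqrt{T^*T}$ (non-negative reals) in decreasing order, counted with multiplicity. For $p\in(0,+\infty)$, $S_p(J)=\{T\in\mathcal{B}_0(\mathcal{H}):[T,J]=0,\ (\lambda_n(T))_n\in\ell^p\}$ and $\|T\|_p=(\sum_n\lambda_n(T)^p)^{1/p}$ (with value $+\infty$ if the sum diverges). *)

theory Defs
  imports "HOL-Analysis.Analysis"
begin

section \<open>Quaternions\<close>

codatatype quat = Quat (qRe: real) (qIm1: real) (qIm2: real) (qIm3: real)

lemma quat_eq_iff: "x = y \<longleftrightarrow> qRe x = qRe y \<and> qIm1 x = qIm1 y \<and> qIm2 x = qIm2 y \<and> qIm3 x = qIm3 y"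
  by (auto intro: quat.expand)

instantiation quat :: ab_group_add
begin

primcorec zero_quat where
  "qRe 0 = 0" | "qIm1 0 = 0" | "qIm2 0 = 0" | "qIm3 0 = 0"

primcorec plus_quat where
  "qRe (x + y) = qRe x + qRe y"
| "qIm1 (x + y) = qIm1 x + qIm1 y"
| "qIm2 (x + y) = qIm2 x + qIm2 y"
| "qIm3 (x + y) = qIm3 x + qIm3 y"

primcorec uminus_quat where
  "qRe (- x) = - qRe x"
| "qIm1 (- x) = - qIm1 x"
| "qIm2 (- x) = - qIm2 x"
| "qIm3 (- x) = - qIm3 x"

primcorec minus_quat where
  "qRe (x - y) = qRe x - qRe y"
| "qIm1 (x - y) = qIm1 x - qIm1 y"
| "qIm2 (x - y) = qIm2 x - qIm2 y"
| "qIm3 (x - y) = qIm3 x - qIm3 y"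

instance by standard (simp_all add: quat_eq_iff)

end

instantiation quat :: ring_1
begin

primcorec one_quat where
  "qRe 1 = 1" | "qIm1 1 = 0" | "qIm2 1 = 0" | "qIm3 1 = 0"

primcorec times_quat where
  "qRe (x * y) = qRe x * qRe y - qIm1 x * qIm1 y - qIm2 x * qIm2 y - qIm3 x * qIm3 y"
| "qIm1 (x * y) = qRe x * qIm1 y + qIm1 x * qRe y + qIm2 x * qIm3 y - qIm3 x * qIm2 y"
| "qIm2 (x * y) = qRe x * qIm2 y - qIm1 x * qIm3 y + qIm2 x * qRe y + qIm3 x * qIm1 y"
| "qIm3 (x * y) = qRe x * qIm3 y + qIm1 x * qIm2 y - qIm2 x * qIm1 y + qIm3 x * qRe y"

instance by standard (simp_all add: quat_eq_iff algebra_simps)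

end

primcorec qcnj :: "quat \<Rightarrow> quat" where
  "qRe (qcnj x) = qRe x"
| "qIm1 (qcnj x) = - qIm1 x"
| "qIm2 (qcnj x) = - qIm2 x"
| "qIm3 (qcnj x) = - qIm3 x"

instantiation quat :: real_algebra_1
begin

primcorec scaleR_quat where
  "qRe (scaleR r x) = r * qRe x"
| "qIm1 (scaleR r x) = r * qIm1 x"
| "qIm2 (scaleR r x) = r * qIm2 x"
| "qIm3 (scaleR r x) = r * qIm3 x"

instance by standard (simp_all add: quat_eq_iff algebra_simps)

end

instantiation quat :: real_inner
begin

definition inner_quat :: "quat \<Rightarrow> quat \<Rightarrow> real" where
  "inner_quat x y = qRe x * qRe y + qIm1 x * qIm1 y + qIm2 x * qIm2 y + qIm3 x * qIm3 y"

definition norm_quat :: "quat \<Rightarrow> real" where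
  "norm_quat x = sqrt (inner x x)"

definition sgn_quat :: "quat \<Rightarrow> quat" where
  "sgn_quat x = x /\<^sub>R norm x"

definition dist_quat :: "quat \<Rightarrow> quat \<Rightarrow> real" where
  "dist_quat x y = norm (x - y)"

definition uniformity_quat :: "(quat \<times> quat) filter" where
  "uniformity_quat = (INF e\<in>{0<..}. principal {(x, y). dist x y < e})"

definition open_quat :: "quat set \<Rightarrow> bool" where
  "open_quat U \<longleftrightarrow> (\<forall>x\<in>U. eventually (\<lambda>(x', y). x' = x \<longrightarrow> y \<in> U) uniformity)"

instance
proof
  fix x :: quat
  have "inner x x = 0 \<longleftrightarrow> (qRe x)\<^sup>2 + (qIm1 x)\<^sup>2 + (qIm2 x)\<^sup>2 + (qIm3 x)\<^sup>2 = 0"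
    by (simp add: inner_quat_def power2_eq_square)
  also have "\<dots> \<longleftrightarrow> x = 0"
    by (simp add: add_nonneg_eq_0_iff quat_eq_iff)
  finally show "inner x x = 0 \<longleftrightarrow> x = 0" .
qed (simp_all add: inner_quat_def norm_quat_def sgn_quat_def dist_quat_def
      uniformity_quat_def open_quat_def algebra_simps)

end

instantiation quat :: real_normed_div_algebra
begin

definition inverse_quat :: "quat \<Rightarrow> quat" where
  "inverse_quat x = qcnj x /\<^sub>R (norm x)\<^sup>2"

definition divide_quat :: "quat \<Rightarrow> quat \<Rightarrow> quat" where
  "divide_quat x y = x * inverse y"

instance
proof
  fix x y :: quat
  have sq: "(norm z)\<^sup>2 = qRe z * qRe z + qIm1 z * qIm1 z + qIm2 z * qIm2 z + qIm3 z * qIm3 z" for z :: quat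
    by (simp add: power2_norm_eq_inner inner_quat_def)
  show "inverse x * x = 1" "x * inverse x = 1" if "x \<noteq> 0"
  proof -
    have nz: "(norm x)\<^sup>2 \<noteq> 0" using that by simp
    have "qcnj x * x = (norm x)\<^sup>2 *\<^sub>R 1" "x * qcnj x = (norm x)\<^sup>2 *\<^sub>R 1"
      by (simp_all add: quat_eq_iff sq)
    then show "inverse x * x = 1" "x * inverse x = 1"
      using nz by (simp_all add: inverse_quat_def)
  qed
  have "(norm (x * y))\<^sup>2 = (norm x * norm y)\<^sup>2"
    by (simp add: sq power_mult_distrib) algebra
  then show "norm (x * y) = norm x * norm y"
    by (simp add: power2_eq_iff_nonneg)
qed (simp_all add: inverse_quat_def divide_quat_def)

end

definition imaginary_units :: "quat set" where
  "imaginary_units = {q. qRe q = 0 \<and> norm q = 1}"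


section \<open>Quaternionic Hilbert spaces\<close>

text \<open>
  The real vector space structure and the norm are not extra data: they are the ones induced by
  the right quaternionic structure and by the scalar product.
\<close>

class quaternionic_vector = real_vector +
  fixes rscale :: "'a \<Rightarrow> quat \<Rightarrow> 'a"  (infixl \<open>\<cdot>\<^sub>q\<close> 75)
  assumes rscale_add_left: "(x + y) \<cdot>\<^sub>q a = x \<cdot>\<^sub>q a + y \<cdot>\<^sub>q a"
    and rscale_add_right: "x \<cdot>\<^sub>q (a + b) = x \<cdot>\<^sub>q a + x \<cdot>\<^sub>q b"
    and rscale_mult: "x \<cdot>\<^sub>q (a * b) = (x \<cdot>\<^sub>q a) \<cdot>\<^sub>q b"
    and rscale_one: "x \<cdot>\<^sub>q 1 = x"
    and scaleR_eq_rscale: "r *\<^sub>R x = x \<cdot>\<^sub>q of_real r"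

class quaternionic_hilbert = quaternionic_vector + banach +
  fixes qinner :: "'a \<Rightarrow> 'a \<Rightarrow> quat"
  assumes qinner_cnj: "qinner x y = qcnj (qinner y x)"
    and qinner_add_right: "qinner x (y + z) = qinner x y + qinner x z"
    and qinner_rscale_right: "qinner x (y \<cdot>\<^sub>q a) = qinner x y * a"
    and qinner_nonneg: "0 \<le> qRe (qinner x x)"
    and qinner_eq_zero_iff: "qinner x x = 0 \<longleftrightarrow> x = 0"
    and norm_eq_sqrt_qinner: "norm x = sqrt (qRe (qinner x x))"

definition qorthonormal :: "'a::quaternionic_hilbert set \<Rightarrow> bool" where
  "qorthonormal E \<longleftrightarrow> (\<forall>x\<in>E. \<forall>y\<in>E. qinner x y = (if x = y then 1 else 0))"

definition qsubspace :: "'a::quaternionic_vector set \<Rightarrow> bool" where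
  "qsubspace V \<longleftrightarrow> 0 \<in> V \<and> (\<forall>x\<in>V. \<forall>y\<in>V. x + y \<in> V) \<and> (\<forall>x\<in>V. \<forall>a. x \<cdot>\<^sub>q a \<in> V)"

definition qspan :: "'a::quaternionic_vector set \<Rightarrow> 'a set" where
  "qspan S = qsubspace hull S"

definition qindependent :: "'a::quaternionic_vector set \<Rightarrow> bool" where
  "qindependent S \<longleftrightarrow> (\<forall>x\<in>S. x \<notin> qspan (S - {x}))"

text \<open>As for \<^const>\<open>dim\<close>, infinite-dimensional subspaces get the value 0.\<close>

definition qdim :: "'a::quaternionic_vector set \<Rightarrow> nat" where
  "qdim V = card (SOME B. qindependent B \<and> qspan B = V)"


section \<open>Operators\<close>

definition bounded_qlinear :: "('a::quaternionic_hilbert \<Rightarrow> 'a) \<Rightarrow> bool" where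
  "bounded_qlinear T \<longleftrightarrow> bounded_linear T \<and> (\<forall>x a. T (x \<cdot>\<^sub>q a) = T x \<cdot>\<^sub>q a)"

definition compact_qlinear :: "('a::quaternionic_hilbert \<Rightarrow> 'a) \<Rightarrow> bool" where
  "compact_qlinear T \<longleftrightarrow> bounded_qlinear T \<and> (\<forall>S. bounded S \<longrightarrow> compact (closure (T ` S)))"

text \<open>Meaningful for bounded right linear operators, where existence is the Riesz theorem.\<close>

definition qadjoint :: "('a::quaternionic_hilbert \<Rightarrow> 'a) \<Rightarrow> 'a \<Rightarrow> 'a" where
  "qadjoint T = (THE S. \<forall>x y. qinner (S x) y = qinner x (T y))"

definition anti_selfadjoint :: "('a::quaternionic_hilbert \<Rightarrow> 'a) \<Rightarrow> bool" where
  "anti_selfadjoint J \<longleftrightarrow> qadjoint J = (\<lambda>x. - J x)"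

definition qunitary :: "('a::quaternionic_hilbert \<Rightarrow> 'a) \<Rightarrow> bool" where
  "qunitary J \<longleftrightarrow> qadjoint J \<circ> J = id \<and> J \<circ> qadjoint J = id"

definition commutator :: "('a::quaternionic_hilbert \<Rightarrow> 'a) \<Rightarrow> ('a \<Rightarrow> 'a) \<Rightarrow> 'a \<Rightarrow> 'a" where
  "commutator T J = (\<lambda>x. T (J x) - J (T x))"

definition plus_slice :: "('a::quaternionic_hilbert \<Rightarrow> 'a) \<Rightarrow> quat \<Rightarrow> 'a set" where
  "plus_slice J i = {x. J x = x \<cdot>\<^sub>q i}"

text \<open>
  Over the quaternions, \<open>\<langle>x, A x\<rangle> \<in> [0, \<infinity>)\<close> for all \<open>x\<close> already forces \<open>A\<close> to be selfadjoint.
\<close>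

definition qpositive :: "('a::quaternionic_hilbert \<Rightarrow> 'a) \<Rightarrow> bool" where
  "qpositive A \<longleftrightarrow> bounded_qlinear A \<and> (\<forall>x. \<exists>r\<ge>0. qinner x (A x) = of_real r)"

definition op_abs :: "('a::quaternionic_hilbert \<Rightarrow> 'a) \<Rightarrow> 'a \<Rightarrow> 'a" where
  "op_abs T = (THE A. qpositive A \<and> A \<circ> A = qadjoint T \<circ> T)"


section \<open>Singular values and Schatten classes\<close>

text \<open>Only real eigenvalues are considered, so the eigenspace is a right subspace.\<close>

definition eigen_multiplicity :: "('a::quaternionic_hilbert \<Rightarrow> 'a) \<Rightarrow> real \<Rightarrow> nat" where
  "eigen_multiplicity A \<mu> = qdim {x. A x = x \<cdot>\<^sub>q of_real \<mu>}"

text \<open>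
  The decreasing sequence in which every positive eigenvalue of \<open>|T|\<close> occurs as often as its
  multiplicity; if there are only finitely many, the sequence is continued by 0.
\<close>

definition singular_value :: "('a::quaternionic_hilbert \<Rightarrow> 'a) \<Rightarrow> nat \<Rightarrow> real" where
  "singular_value T = (THE s. decseq s \<and> (\<forall>n. 0 \<le> s n) \<and>
     (\<forall>\<mu>>0. finite {n. s n = \<mu>} \<and> card {n. s n = \<mu>} = eigen_multiplicity (op_abs T) \<mu>))"

definition schatten_class :: "real \<Rightarrow> ('a::quaternionic_hilbert \<Rightarrow> 'a) \<Rightarrow> ('a \<Rightarrow> 'a) set" where
  "schatten_class p J = {T. compact_qlinear T \<and> commutator T J = (\<lambda>x. 0) \<and>
     summable (\<lambda>n. singular_value T n powr p)}"

text \<open>Powers with exponent \<open>a > 0\<close> on \<open>[0, \<infinity>]\<close>.\<close>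

definition ennpowr :: "ennreal \<Rightarrow> real \<Rightarrow> ennreal" where
  "ennpowr x a = (if x = \<infinity> then \<infinity> else ennreal (enn2real x powr a))"

definition schatten_norm :: "real \<Rightarrow> ('a::quaternionic_hilbert \<Rightarrow> 'a) \<Rightarrow> ennreal" where
  "schatten_norm p T = ennpowr (\<Sum>n. ennreal (singular_value T n powr p)) (1 / p)"

end

theory Submission
  imports Defs
begin

text \<open>
  The operator \<open>B = T\<^sup>* T\<close> is compact and commutes with \<open>J\<close>. Every nonzero closed right
  subspace that is invariant under \<open>B\<close> contains an eigenvector of \<open>B\<close>, because \<open>\<parallel>T x\<parallel>\<close> attains its supremum
  on the unit sphere (or vanishes there); and every nonzero right subspace that is invariant under \<open>J\<close>
  meets \<open>\<H>\<^sub>+\<^sup>J\<^sup>i\<close>, since for \<open>v \<noteq> 0\<close> one has \<open>v - J v i \<in> \<H>\<^sub>+\<^sup>J\<^sup>i\<close>, and \<open>v j \<in> \<H>\<^sub>+\<^sup>J\<^sup>i\<close> for \<open>j\<close> anticommuting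
  with \<open>i\<close> when that difference is zero. Hence a maximal orthonormal set \<open>E\<close> of eigenvectors of \<open>B\<close> in
  \<open>\<H>\<^sub>+\<^sup>J\<^sup>i\<close> is a Hilbert basis of the whole space, and the numbers \<open>\<parallel>T e\<parallel>\<close> for \<open>e \<in> E\<close> are the singular
  values, so \<open>E\<close> attains the supremum.

  For any orthonormal set \<open>F\<close>, \<open>\<parallel>T f\<parallel>\<^sup>2\<close> is the average of the \<open>\<parallel>T e\<parallel>\<^sup>2\<close> with weights \<open>|\<langle>e, f\<rangle>|\<^sup>2\<close>. Jensen's
  inequality for the exponent \<open>p/2 \<ge> 1\<close>, summed over \<open>f\<close> with Bessel's inequality
  \<open>\<Sum>\<^sub>f |\<langle>e, f\<rangle>|\<^sup>2 \<le> 1\<close>, bounds \<open>\<Sum>\<^sub>f \<parallel>T f\<parallel>\<^sup>p\<close> by \<open>\<Sum>\<^sub>e \<parallel>T e\<parallel>\<^sup>p\<close>.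
\<close>

section \<open>Quaternions and the scalar product\<close>

lemma quat_of_real_sel [simp]:
  "qRe (of_real r) = r" "qIm1 (of_real r) = 0" "qIm2 (of_real r) = 0" "qIm3 (of_real r) = 0"
  by (simp_all add: of_real_def)

lemma quat_of_real_power_sel [simp]:
  "qRe (of_real r ^ n) = r ^ n" "qIm1 (of_real r ^ n) = 0" "qIm2 (of_real r ^ n) = 0" "qIm3 (of_real r ^ n) = 0"
  by (simp_all flip: of_real_power)

lemma norm_quat_sq: "(norm z)\<^sup>2 = (qRe z)\<^sup>2 + (qIm1 z)\<^sup>2 + (qIm2 z)\<^sup>2 + (qIm3 z)\<^sup>2"
  by (simp only: power2_norm_eq_inner inner_quat_def) (simp add: power2_eq_square)

lemma qcnj_simps [simp]:
  "qcnj 0 = 0" "qcnj 1 = 1" "qcnj (of_real r) = of_real r" "qcnj (qcnj a) = a" "qcnj (- a) = - qcnj a"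
  by (simp_all add: quat_eq_iff)

lemma qcnj_add: "qcnj (a + b) = qcnj a + qcnj b"
  and qcnj_mult: "qcnj (a * b) = qcnj b * qcnj a"
  by (simp_all add: quat_eq_iff algebra_simps)

lemma norm_qcnj [simp]: "norm (qcnj a) = norm a"
  by (simp add: norm_quat_def inner_quat_def)

lemma qcnj_mult_self: "qcnj a * a = of_real ((norm a)\<^sup>2)"
  and mult_qcnj_self: "a * qcnj a = of_real ((norm a)\<^sup>2)"
  by (simp_all add: quat_eq_iff norm_quat_sq) (simp_all add: power2_eq_square)

lemma qRe_le_norm: "qRe a \<le> norm a"
proof -
  have "(qRe a)\<^sup>2 \<le> (norm a)\<^sup>2" by (simp add: norm_quat_sq)
  then show ?thesis by (meson abs_le_square_iff abs_norm_cancel order_trans abs_ge_self norm_ge_zero power2_le_imp_le)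
qed

lemma quat_of_real_commute: "a * of_real r = of_real r * (a::quat)"
  by (simp add: quat_eq_iff)

lemma imaginary_units_square: "i \<in> imaginary_units \<Longrightarrow> i * i = - 1"
proof -
  assume "i \<in> imaginary_units"
  then have r: "qRe i = 0" and n: "norm i = 1" by (auto simp: imaginary_units_def)
  from norm_quat_sq[of i] r n show "i * i = - 1"
    by (simp add: quat_eq_iff power2_eq_square)
qed

text \<open>Purely imaginary quaternions anticommute exactly when their vector parts are orthogonal,
  so any nonzero vector orthogonal to \<open>i\<close> will do. Rotating the first two components of
  \<open>i\<close> by a right angle gives one, unless both vanish; then the first unit is orthogonal
  to \<open>i\<close>.\<close>

lemma ex_anticommuting_quat:
  assumes "i \<in> imaginary_units"
  shows "\<exists>j. j \<noteq> 0 \<and> j * i = - (i * j)"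
proof (cases "qIm1 i = 0 \<and> qIm2 i = 0")
  case True
  then show ?thesis using assms
    by (intro exI[of _ "Quat 0 1 0 0"]) (auto simp: quat_eq_iff imaginary_units_def)
next
  case False
  then show ?thesis using assms
    by (intro exI[of _ "Quat 0 (- qIm2 i) (qIm1 i) 0"]) (auto simp: quat_eq_iff imaginary_units_def)
qed

section \<open>Right scalar multiplication, the scalar product and the Cauchy-Schwarz
  inequality\<close>

lemma rscale_zero [simp]: "(x::'a::quaternionic_vector) \<cdot>\<^sub>q 0 = 0"
  and zero_rscale [simp]: "(0::'a) \<cdot>\<^sub>q a = 0"
  using rscale_add_right[of x 0 0] rscale_add_left[of "0::'a" 0 a] by simp_all

lemma rscale_minus_right: "(x::'a::quaternionic_vector) \<cdot>\<^sub>q (- a) = - (x \<cdot>\<^sub>q a)"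
  and rscale_minus_left: "(- x) \<cdot>\<^sub>q a = - (x \<cdot>\<^sub>q a)"
  using rscale_add_right[of x a "- a"] rscale_add_left[of x "- x" a]
  by (simp_all add: eq_neg_iff_add_eq_0 add.commute)

lemma rscale_diff_right: "(x::'a::quaternionic_vector) \<cdot>\<^sub>q (a - b) = x \<cdot>\<^sub>q a - x \<cdot>\<^sub>q b"
  and rscale_diff_left: "(x - y) \<cdot>\<^sub>q a = x \<cdot>\<^sub>q a - y \<cdot>\<^sub>q a"
  by (simp_all only: diff_conv_add_uminus rscale_add_right rscale_add_left rscale_minus_right rscale_minus_left)

lemma rscale_scaleR: "(x::'a::quaternionic_vector) \<cdot>\<^sub>q (r *\<^sub>R a) = r *\<^sub>R (x \<cdot>\<^sub>q a)"
  and scaleR_rscale: "(r *\<^sub>R x) \<cdot>\<^sub>q a = r *\<^sub>R (x \<cdot>\<^sub>q a)"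
  by (simp_all only: scaleR_eq_rscale scaleR_conv_of_real rscale_mult[symmetric] quat_of_real_commute)

lemma qinner_add_left: "qinner (x + y) z = qinner x z + qinner y z"
  by (metis qinner_cnj qcnj_add qinner_add_right)

lemma qinner_rscale_left: "qinner (x \<cdot>\<^sub>q a) y = qcnj a * qinner x y"
  by (metis qinner_cnj qcnj_mult qinner_rscale_right)

lemma qinner_zero [simp]: "qinner x 0 = 0" "qinner 0 x = 0"
  using qinner_add_right[of x 0 0] qinner_add_left[of 0 0 x] by simp_all

lemma qinner_minus_right: "qinner x (- y) = - qinner x y"
  and qinner_minus_left: "qinner (- x) y = - qinner x y"
  using qinner_add_right[of x y "- y"] qinner_add_left[of x "- x" y]
  by (simp_all add: eq_neg_iff_add_eq_0 add.commute)

lemma qinner_diff_right: "qinner x (y - z) = qinner x y - qinner x z"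
  and qinner_diff_left: "qinner (x - y) z = qinner x z - qinner y z"
  by (simp_all only: diff_conv_add_uminus qinner_add_right qinner_add_left qinner_minus_right qinner_minus_left)

lemma qinner_scaleR_right: "qinner x (r *\<^sub>R y) = r *\<^sub>R qinner x y"
  and qinner_scaleR_left: "qinner (r *\<^sub>R x) y = r *\<^sub>R qinner x y"
  by (simp_all add: scaleR_eq_rscale qinner_rscale_right qinner_rscale_left scaleR_conv_of_real quat_of_real_commute[of "qinner x y"])

lemma qinner_sum_right: "qinner x (sum f A) = (\<Sum>a\<in>A. qinner x (f a))"
  by (induction A rule: infinite_finite_induct) (simp_all add: qinner_add_right)

lemma qinner_sum_left: "qinner (sum f A) x = (\<Sum>a\<in>A. qinner (f a) x)"
  by (induction A rule: infinite_finite_induct) (simp_all add: qinner_add_left)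

lemma qinner_self: "qinner x x = of_real ((norm x)\<^sup>2)"
proof -
  have "qIm1 (qinner x x) = 0" "qIm2 (qinner x x) = 0" "qIm3 (qinner x x) = 0"
    using qinner_cnj[of x x] by (simp_all add: quat_eq_iff)
  then show ?thesis by (simp add: quat_eq_iff norm_eq_sqrt_qinner qinner_nonneg)
qed

lemma qinner_eq_zero_commute: "qinner x y = 0 \<longleftrightarrow> qinner y x = 0"
  by (metis qinner_cnj qcnj_simps(1))

lemma norm_rscale: "norm ((x::'a::quaternionic_hilbert) \<cdot>\<^sub>q a) = norm x * norm a"
proof -
  have "of_real ((norm (x \<cdot>\<^sub>q a))\<^sup>2) = qcnj a * (qinner x x * a)"
    by (metis qinner_self qinner_rscale_left qinner_rscale_right)
  also have "\<dots> = of_real ((norm a)\<^sup>2) * of_real ((norm x)\<^sup>2)"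
    by (simp only: qinner_self quat_of_real_commute[symmetric, of _ a] mult.assoc[symmetric] qcnj_mult_self)
  also have "\<dots> = of_real ((norm x * norm a)\<^sup>2)"
    by (simp only: of_real_mult[symmetric] power_mult_distrib mult.commute)
  finally have "(norm (x \<cdot>\<^sub>q a))\<^sup>2 = (norm x * norm a)\<^sup>2"
    using of_real_eq_iff by blast
  then show ?thesis by (simp add: power2_eq_iff_nonneg)
qed

lemma norm_sq_add: "(norm (x + y))\<^sup>2 = (norm x)\<^sup>2 + 2 * qRe (qinner x y) + (norm (y::'a::quaternionic_hilbert))\<^sup>2"
proof -
  have "(norm (x + y))\<^sup>2 = qRe (qinner (x + y) (x + y))" by (simp add: qinner_self)
  also have "\<dots> = (norm x)\<^sup>2 + 2 * qRe (qinner x y) + (norm y)\<^sup>2"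
    unfolding qinner_add_left qinner_add_right qinner_cnj[of y x] by (simp add: qinner_self)
  finally show ?thesis .
qed

lemma norm_sq_diff: "(norm (x - y))\<^sup>2 = (norm x)\<^sup>2 - 2 * qRe (qinner x y) + (norm (y::'a::quaternionic_hilbert))\<^sup>2"
  using norm_sq_add[of x "- y"] by (simp add: qinner_minus_right)

lemma norm_qinner_le: "norm (qinner x y) \<le> norm x * norm y"
proof (cases "y = 0")
  case False
  define a where "a = qinner y x"
  let ?n = "(norm y)\<^sup>2"
  have n: "?n > 0" using False by simp
  \<comment> \<open>This is the component of \<open>x\<close> orthogonal to \<open>y\<close>,
    multiplied by \<open>?n\<close> to avoid a division; its squared norm gives
    Cauchy-Schwarz.\<close>
  have "0 \<le> (norm (?n *\<^sub>R x - y \<cdot>\<^sub>q a))\<^sup>2" by simp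
  also have "\<dots> = ?n\<^sup>2 * (norm x)\<^sup>2 - 2 * (?n * (norm a)\<^sup>2) + ?n * (norm a)\<^sup>2"
  proof -
    have "qinner x y = qcnj a" by (metis a_def qinner_cnj)
    then have "qinner (?n *\<^sub>R x) (y \<cdot>\<^sub>q a) = of_real (?n * (norm a)\<^sup>2)"
      by (simp add: qinner_scaleR_left qinner_rscale_right qcnj_mult_self scaleR_conv_of_real mult.assoc)
    then have "qRe (qinner (?n *\<^sub>R x) (y \<cdot>\<^sub>q a)) = ?n * (norm a)\<^sup>2" by (simp only: quat_of_real_sel)
    then show ?thesis unfolding norm_sq_diff by (simp add: norm_rscale power_mult_distrib)
  qed
  finally have "?n * (norm a)\<^sup>2 \<le> ?n * (?n * (norm x)\<^sup>2)" by (simp add: power2_eq_square algebra_simps)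
  then have "(norm a)\<^sup>2 \<le> (norm x * norm y)\<^sup>2" using n
    by (metis mult_le_cancel_left_pos power_mult_distrib mult.commute)
  then have "norm a \<le> norm x * norm y" by (rule power2_le_imp_le) simp
  then show ?thesis by (metis a_def qinner_cnj norm_qcnj)
qed simp

lemma bounded_bilinear_qinner: "bounded_bilinear (qinner :: 'a::quaternionic_hilbert \<Rightarrow> 'a \<Rightarrow> quat)"
  by unfold_locales
     (auto simp: qinner_add_left qinner_add_right qinner_scaleR_left qinner_scaleR_right
           intro!: exI[of _ 1] norm_qinner_le)

lemmas bounded_linear_qinner_right = bounded_bilinear.bounded_linear_right[OF bounded_bilinear_qinner]

lemma qinner_eqI:
  assumes "\<And>y. qinner x y = qinner x' y"
  shows "x = x'"
  by (metis assms eq_iff_diff_eq_0 qinner_diff_left qinner_eq_zero_iff)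

section \<open>Orthonormal expansions\<close>

lemma qorthonormal_subset: "qorthonormal E \<Longrightarrow> F \<subseteq> E \<Longrightarrow> qorthonormal F"
  unfolding qorthonormal_def by blast

lemma qorthonormal_norm: "qorthonormal E \<Longrightarrow> e \<in> E \<Longrightarrow> norm e = 1"
  by (simp add: qorthonormal_def norm_eq_sqrt_qinner)

lemma qinner_orthonormal_sum:
  assumes "qorthonormal E" "finite F" "F \<subseteq> E" "e \<in> E"
  shows "qinner e (\<Sum>f\<in>F. f \<cdot>\<^sub>q c f) = (if e \<in> F then c e else 0)"
proof -
  have "qinner e (\<Sum>f\<in>F. f \<cdot>\<^sub>q c f) = (\<Sum>f\<in>F. if e = f then c f else 0)"
    unfolding qinner_sum_right using assms
    by (intro sum.cong) (auto simp: qinner_rscale_right qorthonormal_def subset_iff)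
  then show ?thesis using assms(2) by simp
qed

lemma norm_sq_orthonormal_sum:
  assumes "qorthonormal E" "finite F" "F \<subseteq> E"
  shows "(norm (\<Sum>e\<in>F. e \<cdot>\<^sub>q c e))\<^sup>2 = (\<Sum>e\<in>F. (norm (c e))\<^sup>2)"
proof -
  have "of_real ((norm (\<Sum>e\<in>F. e \<cdot>\<^sub>q c e))\<^sup>2) = (\<Sum>e\<in>F. qinner (e \<cdot>\<^sub>q c e) (\<Sum>f\<in>F. f \<cdot>\<^sub>q c f))"
    by (simp only: qinner_sum_left flip: qinner_self)
  also have "\<dots> = (\<Sum>e\<in>F. qcnj (c e) * c e)"
    using assms by (intro sum.cong) (auto simp: qinner_rscale_left qinner_orthonormal_sum[OF assms])
  also have "\<dots> = of_real (\<Sum>e\<in>F. (norm (c e))\<^sup>2)"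
    by (simp add: qcnj_mult_self)
  finally show ?thesis using of_real_eq_iff by blast
qed

text \<open>By Pythagoras, squared distances between nested finite partial sums are differences of
  partial sums of \<open>(norm (c e))^2\<close>. Convergence of the latter makes the former Cauchy,
  and the space is complete.\<close>

lemma orthonormal_summable:
  fixes c :: "'a::quaternionic_hilbert \<Rightarrow> quat"
  assumes E: "qorthonormal E" and c: "(\<lambda>e. (norm (c e))\<^sup>2) summable_on E"
  shows "(\<lambda>e. e \<cdot>\<^sub>q c e) summable_on E"
proof -
  let ?g = "\<lambda>e. (norm (c e))\<^sup>2" and ?f = "\<lambda>e. e \<cdot>\<^sub>q c e"
  from c obtain L where lim: "(sum ?g \<longlongrightarrow> L) (finite_subsets_at_top E)"
    unfolding has_sum_def summable_on_def by blast
  have "\<exists>P. eventually P (finite_subsets_at_top E) \<and>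
            (\<forall>F F'. P F \<and> P F' \<longrightarrow> dist (sum ?f F) (sum ?f F') < d)" if d: "d > 0" for d
  proof -
    \<comment> \<open>Chosen so that \<open>2 * \<epsilon> = (d / 2)^2\<close>: two sums within
      \<open>\<epsilon>\<close> of \<open>L\<close> differ by less than
      \<open>2 * \<epsilon>\<close>.\<close>
    define \<epsilon> where "\<epsilon> = d\<^sup>2 / 8"
    have \<epsilon>: "\<epsilon> > 0" using d by (simp add: \<epsilon>_def)
    have "\<exists>X. finite X \<and> X \<subseteq> E \<and> (\<forall>Y. finite Y \<and> X \<subseteq> Y \<and> Y \<subseteq> E \<longrightarrow> dist (sum ?g Y) L < \<epsilon>)"
      using tendstoD[OF lim \<epsilon>] by (simp only: eventually_finite_subsets_at_top)
    then obtain X where X: "finite X" "X \<subseteq> E"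
      and XL: "\<And>Y. finite Y \<Longrightarrow> X \<subseteq> Y \<Longrightarrow> Y \<subseteq> E \<Longrightarrow> dist (sum ?g Y) L < \<epsilon>"
      by metis
    let ?P = "\<lambda>F. finite F \<and> X \<subseteq> F \<and> F \<subseteq> E"
    have close: "norm (sum ?f F - sum ?f X) < d / 2" if F: "?P F" for F
    proof -
      have "(norm (sum ?f F - sum ?f X))\<^sup>2 = (norm (sum ?f (F - X)))\<^sup>2"
        using F by (simp add: sum_diff)
      also have "\<dots> = sum ?g (F - X)" using F by (intro norm_sq_orthonormal_sum[OF E]) auto
      also have "\<dots> = sum ?g F - sum ?g X" using F by (simp add: sum_diff)
      also have "\<dots> < 2 * \<epsilon>" using XL[of F] XL[of X] F X by (auto simp: dist_real_def)
      also have "\<dots> = (d / 2)\<^sup>2" by (simp add: \<epsilon>_def power2_eq_square)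
      finally show ?thesis by (rule power2_less_imp_less) (use d in simp)
    qed
    have "dist (sum ?f F) (sum ?f F') < d" if "?P F" "?P F'" for F F'
      using close[OF that(1)] close[OF that(2)]
      by (smt (verit) dist_norm dist_triangle2 field_sum_of_halves)
    moreover have "eventually ?P (finite_subsets_at_top E)"
      unfolding eventually_finite_subsets_at_top using X by blast
    ultimately show ?thesis by (intro exI[of _ ?P]) blast
  qed
  then have "cauchy_filter (filtermap (sum ?f) (finite_subsets_at_top E))"
    by (simp add: cauchy_filter_metric_filtermap)
  moreover have "complete (UNIV :: 'a set)"
    by (meson Cauchy_convergent UNIV_I complete_def convergent_def)
  ultimately obtain L' where "(sum ?f \<longlongrightarrow> L') (finite_subsets_at_top E)"
    using complete_uniform[where S = "UNIV :: 'a set"] by (force simp add: filterlim_def)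
  then show ?thesis using summable_on_def has_sum_def by blast
qed

text \<open>Continuity of the scalar product and of the norm carries the finite orthogonality
  relations to the limit.\<close>

lemma orthonormal_has_sum:
  fixes c :: "'a::quaternionic_hilbert \<Rightarrow> quat"
  assumes E: "qorthonormal E" and s: "((\<lambda>e. e \<cdot>\<^sub>q c e) has_sum x) E"
  shows "\<And>e. e \<in> E \<Longrightarrow> qinner e x = c e" and "((\<lambda>e. (norm (c e))\<^sup>2) has_sum (norm x)\<^sup>2) E"
proof -
  show "qinner e x = c e" if e: "e \<in> E" for e
  proof -
    have "((\<lambda>f. qinner e (f \<cdot>\<^sub>q c f)) has_sum qinner e x) E"
      by (rule has_sum_bounded_linear[OF bounded_linear_qinner_right s])
    moreover have "((\<lambda>f. qinner e (f \<cdot>\<^sub>q c f)) has_sum c e) E"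
      using E e by (intro has_sum_finite_neutralI[of "{e}"])
        (auto simp: qinner_rscale_right qorthonormal_def)
    ultimately show ?thesis by (rule has_sum_unique)
  qed
  have "((\<lambda>F. (norm (\<Sum>e\<in>F. e \<cdot>\<^sub>q c e))\<^sup>2) \<longlongrightarrow> (norm x)\<^sup>2) (finite_subsets_at_top E)"
    using s unfolding has_sum_def by (intro tendsto_intros)
  then show "((\<lambda>e. (norm (c e))\<^sup>2) has_sum (norm x)\<^sup>2) E"
    unfolding has_sum_def
    by (rule Lim_transform_eventually)
       (auto intro!: eventually_finite_subsets_at_top_weakI norm_sq_orthonormal_sum[OF E])
qed

text \<open>The difference of the two sides is the squared distance from \<open>x\<close> to its
  partial expansion.\<close>

lemma Bessel_finite:
  assumes "qorthonormal E" "finite F" "F \<subseteq> E"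
  shows "(\<Sum>e\<in>F. (norm (qinner e x))\<^sup>2) \<le> (norm x)\<^sup>2"
proof -
  let ?s = "\<Sum>e\<in>F. e \<cdot>\<^sub>q qinner e x" and ?t = "\<Sum>e\<in>F. (norm (qinner e x))\<^sup>2"
  have "qinner x ?s = (\<Sum>e\<in>F. qcnj (qinner e x) * qinner e x)"
    unfolding qinner_sum_right qinner_rscale_right by (intro sum.cong refl) (metis qinner_cnj)
  also have "\<dots> = of_real ?t" by (simp add: qcnj_mult_self)
  finally have "qRe (qinner x ?s) = ?t" by (simp only: quat_of_real_sel)
  then have "(norm (x - ?s))\<^sup>2 = (norm x)\<^sup>2 - ?t"
    by (simp add: norm_sq_diff norm_sq_orthonormal_sum[OF assms])
  then show ?thesis by (metis diff_ge_0_iff_ge zero_le_power2)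
qed

text \<open>A Hilbert basis, described by its trivial orthogonal complement because that is what
  maximality of an orthonormal set delivers.\<close>

definition qcomplete :: "'a::quaternionic_hilbert set \<Rightarrow> bool" where
  "qcomplete E \<longleftrightarrow> qorthonormal E \<and> (\<forall>x. (\<forall>e\<in>E. qinner e x = 0) \<longrightarrow> x = 0)"

text \<open>Bessel makes the series converge to some \<open>y\<close>; then \<open>x - y\<close> has
  all coefficients zero and vanishes by completeness.\<close>

lemma qcomplete_expansion:
  assumes "qcomplete E"
  shows "((\<lambda>e. e \<cdot>\<^sub>q qinner e x) has_sum x) E"
proof -
  have E: "qorthonormal E" using assms by (simp add: qcomplete_def)
  have "(\<lambda>e. (norm (qinner e x))\<^sup>2) summable_on E"
    using Bessel_finite[OF E, of _ x] by (intro nonneg_bdd_above_summable_on) (auto intro!: bdd_aboveI2)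
  from orthonormal_summable[OF E this] obtain y where y: "((\<lambda>e. e \<cdot>\<^sub>q qinner e x) has_sum y) E"
    by (auto simp: summable_on_def)
  then have "qinner e (x - y) = 0" if "e \<in> E" for e
    using orthonormal_has_sum(1)[OF E y that] by (simp add: qinner_diff_right)
  then have "x - y = 0" using assms unfolding qcomplete_def by blast
  with y show ?thesis by simp
qed

lemma Parseval:
  assumes "qcomplete E"
  shows "((\<lambda>e. (norm (qinner e x))\<^sup>2) has_sum (norm x)\<^sup>2) E"
  using orthonormal_has_sum(2)[OF _ qcomplete_expansion[OF assms]] assms by (simp add: qcomplete_def)

text \<open>Zorn's lemma. The predicate \<open>P\<close> allows two uses: with no restriction it
  yields a Hilbert basis, and later it confines the set to eigenvectors in the slice.\<close>

lemma ex_maximal_orthonormal: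
  fixes P :: "'a::quaternionic_hilbert \<Rightarrow> bool"
  shows "\<exists>E. qorthonormal E \<and> Ball E P \<and>
           (\<forall>x. norm x = 1 \<longrightarrow> P x \<longrightarrow> (\<forall>e\<in>E. qinner e x = 0) \<longrightarrow> False)"
proof -
  let ?A = "{E. qorthonormal E \<and> Ball E P}"
  have "\<exists>M\<in>?A. \<forall>X\<in>?A. M \<subseteq> X \<longrightarrow> X = M"
  proof (rule subset_Zorn_nonempty)
    have "{} \<in> ?A" by (simp add: qorthonormal_def)
    then show "?A \<noteq> {}" by blast
    fix C assume C: "C \<noteq> {}" "subset.chain ?A C"
    have "qorthonormal (\<Union>C)" unfolding qorthonormal_def
    proof (intro ballI)
      fix x y assume "x \<in> \<Union>C" "y \<in> \<Union>C"
      then obtain X where "X \<in> C" "x \<in> X" "y \<in> X"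
        using C(2) unfolding subset.chain_def by blast
      then show "qinner x y = (if x = y then 1 else 0)"
        using C(2) unfolding subset.chain_def qorthonormal_def by blast
    qed
    then show "\<Union>C \<in> ?A" using C(2) unfolding subset.chain_def by blast
  qed
  then obtain M where M: "qorthonormal M" "Ball M P"
    and max: "\<And>X. qorthonormal X \<Longrightarrow> Ball X P \<Longrightarrow> M \<subseteq> X \<Longrightarrow> X = M" by auto
  have False if x: "norm x = 1" "P x" "\<forall>e\<in>M. qinner e x = 0" for x
  proof -
    have xx: "qinner x x = 1" using x by (simp add: qinner_self)
    have "qorthonormal (insert x M)"
      using M x xx unfolding qorthonormal_def by (auto simp: qinner_eq_zero_commute[of x])
    then have "x \<in> M" using max[of "insert x M"] M x by auto
    then show False using x xx by auto
  qed
  then show ?thesis using M by blast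
qed

lemma ex_qcomplete: "\<exists>E :: 'a::quaternionic_hilbert set. qcomplete E"
proof -
  from ex_maximal_orthonormal[of "\<lambda>_. True"] obtain E :: "'a set" where E: "qorthonormal E"
    and max: "\<And>x. norm x = 1 \<Longrightarrow> \<forall>e\<in>E. qinner e x = 0 \<Longrightarrow> False" by blast
  have "x = 0" if "\<forall>e\<in>E. qinner e x = 0" for x
    using max[of "(1 / norm x) *\<^sub>R x"] that by (cases "x = 0") (auto simp: qinner_scaleR_right)
  then show ?thesis using E by (auto simp: qcomplete_def)
qed

section \<open>Adjoints\<close>

lemma bounded_qlinearD:
  assumes "bounded_qlinear T"
  shows "bounded_linear T" "T (x \<cdot>\<^sub>q a) = T x \<cdot>\<^sub>q a" "T 0 = 0" "T (x + y) = T x + T y" "T (x - y) = T x - T y"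
    "T (- x) = - T x" "T (r *\<^sub>R x) = r *\<^sub>R T x"
  using assms unfolding bounded_qlinear_def
  by (auto simp: linear_0 linear_add linear_diff linear_neg linear_scale bounded_linear.linear)

lemma bounded_qlinear_eqI:
  assumes E: "qcomplete E" and "bounded_qlinear A" "bounded_qlinear B" and eq: "\<And>e. e \<in> E \<Longrightarrow> A e = B e"
  shows "A = B"
proof
  fix x
  have "((\<lambda>e. C (e \<cdot>\<^sub>q qinner e x)) has_sum C x) E" if "bounded_qlinear C" for C
    by (rule has_sum_bounded_linear[OF bounded_qlinearD(1)[OF that] qcomplete_expansion[OF E]])
  from this[OF assms(2)] this[OF assms(3)] have
    "((\<lambda>e. A e \<cdot>\<^sub>q qinner e x) has_sum A x) E" "((\<lambda>e. B e \<cdot>\<^sub>q qinner e x) has_sum B x) E"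
    by (simp_all add: bounded_qlinearD(2) assms)
  moreover from this(1) have "((\<lambda>e. B e \<cdot>\<^sub>q qinner e x) has_sum A x) E"
    by (subst has_sum_cong[of E _ "\<lambda>e. A e \<cdot>\<^sub>q qinner e x"]) (simp_all add: eq)
  ultimately show "A x = B x" using has_sum_unique by blast
qed

text \<open>The representing vector must have the coefficients \<open>qcnj (\<phi> e)\<close>,
  conjugated because the scalar product is conjugate linear on the left. They are square summable:
  if \<open>?s\<close> is a finite sum of their squared norms, the corresponding vector
  \<open>?x\<close> has squared norm \<open>?s\<close> and satisfies \<open>\<phi> ?x = ?s\<close>,
  so boundedness of \<open>\<phi>\<close> gives \<open>?s^2 \<le> ?s * K^2\<close>.\<close>

lemma Riesz_representation:
  fixes \<phi> :: "'a::quaternionic_hilbert \<Rightarrow> quat"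
  assumes bl: "bounded_linear \<phi>" and ql: "\<And>x a. \<phi> (x \<cdot>\<^sub>q a) = \<phi> x * a"
  shows "\<exists>z. \<forall>y. qinner z y = \<phi> y"
proof -
  obtain E :: "'a set" where E: "qcomplete E" using ex_qcomplete by blast
  then have on: "qorthonormal E" by (simp add: qcomplete_def)
  obtain K where K: "K \<ge> 0" "\<And>x. norm (\<phi> x) \<le> norm x * K" 
    using bounded_linear.nonneg_bounded[OF bl] by auto
  let ?c = "\<lambda>e. qcnj (\<phi> e)"
  have bound: "(\<Sum>e\<in>F. (norm (?c e))\<^sup>2) \<le> K\<^sup>2" if F: "finite F" "F \<subseteq> E" for F
  proof -
    let ?s = "\<Sum>e\<in>F. (norm (?c e))\<^sup>2" and ?x = "\<Sum>e\<in>F. e \<cdot>\<^sub>q ?c e"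
    have s0: "0 \<le> ?s" by (simp add: sum_nonneg)
    have "\<phi> ?x = of_real ?s"
      by (simp add: linear_sum[OF bounded_linear.linear[OF bl]] ql mult_qcnj_self)
    then have "norm (of_real ?s :: quat) \<le> norm ?x * K" using K(2)[of ?x] by simp
    then have "?s \<le> norm ?x * K" using s0 by (simp only: norm_of_real)
    then have "?s\<^sup>2 \<le> (norm ?x * K)\<^sup>2" using s0 by (rule power_mono)
    also have "\<dots> = ?s * K\<^sup>2" by (simp add: power_mult_distrib norm_sq_orthonormal_sum[OF on F])
    finally have "?s * ?s \<le> ?s * K\<^sup>2" by (simp add: power2_eq_square)
    then show ?thesis using s0 by (cases "?s = 0") auto
  qed
  have "(\<lambda>e. (norm (?c e))\<^sup>2) summable_on E"
    using bound by (intro nonneg_bdd_above_summable_on bdd_aboveI2[where M = "K\<^sup>2"]) auto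
  from orthonormal_summable[OF on this] obtain z where z: "((\<lambda>e. e \<cdot>\<^sub>q ?c e) has_sum z) E"
    by (auto simp: summable_on_def)
  have zE: "qinner z e = \<phi> e" if "e \<in> E" for e
    using orthonormal_has_sum(1)[OF on z that] by (metis qinner_cnj qcnj_simps(4))
  have "qinner z y = \<phi> y" for y
  proof -
    note y = qcomplete_expansion[OF E, of y]
    have "((\<lambda>e. qinner z (e \<cdot>\<^sub>q qinner e y)) has_sum qinner z y) E"
      by (rule has_sum_bounded_linear[OF bounded_linear_qinner_right y])
    moreover have "((\<lambda>e. \<phi> (e \<cdot>\<^sub>q qinner e y)) has_sum \<phi> y) E"
      by (rule has_sum_bounded_linear[OF bl y])
    then have "((\<lambda>e. qinner z (e \<cdot>\<^sub>q qinner e y)) has_sum \<phi> y) E"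
      by (subst has_sum_cong[of E _ "\<lambda>e. \<phi> (e \<cdot>\<^sub>q qinner e y)"]) (simp_all add: qinner_rscale_right ql zE)
    ultimately show ?thesis using has_sum_unique by blast
  qed
  then show ?thesis by blast
qed

text \<open>Riesz supplies an operator with the defining property, and the scalar product separates
  points, so the definite description in \<open>qadjoint\<close> denotes it.\<close>

lemma qinner_qadjoint:
  assumes T: "bounded_qlinear T"
  shows "qinner (qadjoint T x) y = qinner x (T y)"
proof -
  have "\<exists>z. \<forall>y. qinner z y = qinner x (T y)" for x
    by (rule Riesz_representation)
      (auto simp: bounded_qlinearD(2)[OF T] qinner_rscale_right
        intro!: bounded_linear_compose[OF bounded_linear_qinner_right] bounded_qlinearD(1)[OF T])
  then obtain S where S: "\<forall>x y. qinner (S x) y = qinner x (T y)" by metis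
  have "\<forall>x y. qinner (qadjoint T x) y = qinner x (T y)"
    unfolding qadjoint_def
  proof (rule theI[of _ S])
    show "\<forall>x y. qinner (S x) y = qinner x (T y)" by (fact S)
    show "S' = S" if "\<forall>x y. qinner (S' x) y = qinner x (T y)" for S'
      using that S by (intro ext qinner_eqI) simp
  qed
  then show ?thesis by blast
qed

lemma qinner_qadjoint_right:
  assumes "bounded_qlinear T"
  shows "qinner x (qadjoint T y) = qinner (T x) y"
  by (metis assms qinner_qadjoint qinner_cnj)

lemma norm_qadjoint_le:
  assumes T: "bounded_qlinear T"
  shows "norm (qadjoint T x) \<le> onorm T * norm x"
proof (cases "qadjoint T x = 0")
  case False
  let ?y = "qadjoint T x"
  have "(norm ?y)\<^sup>2 = qRe (qinner x (T ?y))"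
    by (simp add: qinner_self flip: qinner_qadjoint[OF T])
  also have "\<dots> \<le> norm x * norm (T ?y)"
    by (meson norm_qinner_le order_trans qRe_le_norm)
  also have "\<dots> \<le> norm x * (onorm T * norm ?y)"
    by (intro mult_left_mono onorm bounded_qlinearD(1)[OF T]) simp
  finally show ?thesis using False by (simp add: power2_eq_square mult.assoc mult.left_commute)
next
  case True then show ?thesis using onorm_pos_le[OF bounded_qlinearD(1)[OF T]] by simp
qed

lemma bounded_qlinear_qadjoint:
  assumes T: "bounded_qlinear T"
  shows "bounded_qlinear (qadjoint T)"
  unfolding bounded_qlinear_def
proof (intro conjI allI)
  show "bounded_linear (qadjoint T)"
  proof (rule bounded_linear_intro)
    show "norm (qadjoint T x) \<le> norm x * onorm T" for x
      using norm_qadjoint_le[OF T, of x] by (simp add: mult.commute)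
    show "qadjoint T (x + y) = qadjoint T x + qadjoint T y" for x y
      by (rule qinner_eqI) (simp only: qinner_qadjoint[OF T] qinner_add_left)
    show "qadjoint T (r *\<^sub>R x) = r *\<^sub>R qadjoint T x" for r x
      by (rule qinner_eqI) (simp only: qinner_qadjoint[OF T] qinner_scaleR_left)
  qed
  show "qadjoint T (x \<cdot>\<^sub>q a) = qadjoint T x \<cdot>\<^sub>q a" for x a
    by (rule qinner_eqI) (simp add: qinner_qadjoint[OF T] qinner_rscale_left)
qed

lemma bounded_qlinear_comp:
  "bounded_qlinear S \<Longrightarrow> bounded_qlinear T \<Longrightarrow> bounded_qlinear (S \<circ> T)"
  unfolding bounded_qlinear_def o_def by (auto intro: bounded_linear_compose)

section \<open>Diagonalization of \<open>T\<^sup>* T\<close>\<close>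

lemma qsubspace_scaleR: "qsubspace V \<Longrightarrow> x \<in> V \<Longrightarrow> r *\<^sub>R x \<in> V"
  by (simp add: qsubspace_def scaleR_eq_rscale)

lemma qsubspace_diff: "qsubspace V \<Longrightarrow> x \<in> V \<Longrightarrow> y \<in> V \<Longrightarrow> x - y \<in> V"
  using qsubspace_scaleR[of V y "-1"] unfolding qsubspace_def by (metis scaleR_minus1_left uminus_add_conv_diff add.commute)

text \<open>Take unit vectors in \<open>V\<close> along which \<open>norm (T x)\<close> tends to its
  supremum \<open>M\<close>. Compactness makes their images converge along a subsequence, and the
  estimate \<open>est\<close> turns this into convergence of the vectors themselves, to an
  eigenvector for \<open>M^2\<close>.\<close>

lemma compact_ex_top_eigenvector:
  fixes T :: "'a::quaternionic_hilbert \<Rightarrow> 'a"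
  assumes T: "compact_qlinear T" and V: "qsubspace V" "closed V"
    and inv: "\<And>x. x \<in> V \<Longrightarrow> qadjoint T (T x) \<in> V" and v: "v \<in> V" "v \<noteq> 0"
  shows "\<exists>x\<in>V. \<exists>\<mu>. x \<noteq> 0 \<and> qadjoint T (T x) = \<mu> *\<^sub>R x"
proof -
  let ?B = "\<lambda>x. qadjoint T (T x)"
  have bq: "bounded_qlinear T" using T by (simp add: compact_qlinear_def)
  note bl = bounded_qlinearD(1)[OF bq]
  note blA = bounded_qlinearD(1)[OF bounded_qlinear_qadjoint[OF bq]]
  define S where "S = {x \<in> V. norm x = 1}"
  define M where "M = (SUP x\<in>S. norm (T x))"
  have u: "(1 / norm x) *\<^sub>R x \<in> S" if "x \<in> V" "x \<noteq> 0" for x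
    using that V by (simp add: S_def qsubspace_scaleR)
  have S: "S \<noteq> {}" using u[OF v] by blast
  have bdd: "bdd_above ((\<lambda>x. norm (T x)) ` S)"
  proof (rule bdd_aboveI2)
    show "norm (T x) \<le> onorm T" if "x \<in> S" for x
      using onorm[OF bl, of x] that by (simp add: S_def)
  qed
  have MS: "norm (T x) \<le> M" if "x \<in> S" for x
    unfolding M_def using that by (intro cSUP_upper bdd)
  have MV: "norm (T x) \<le> M * norm x" if "x \<in> V" for x
  proof (cases "x = 0")
    case False
    with MS[OF u[OF that False]] show ?thesis
      by (simp add: bounded_qlinearD[OF bq] divide_simps)
  qed (simp add: bounded_qlinearD[OF bq])
  have M0: "M \<ge> 0" using S MS norm_ge_zero order_trans by blast
  show ?thesis
  proof (cases "M = 0")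
    case True
    then have "T v = 0" using MV[OF v(1)] by simp
    then have "?B v = 0 *\<^sub>R v" by (simp add: linear_0 bounded_linear.linear[OF blA])
    then show ?thesis using v by blast
  next
    case False
    with M0 have M: "M > 0" by simp
    have "\<exists>x\<in>S. M - 1 / Suc n < norm (T x)" for n
      using less_cSUP_iff[OF S bdd, of "M - 1 / Suc n"] by (simp add: M_def)
    then obtain x where xS: "\<And>n. x n \<in> S" and xM: "\<And>n. M - 1 / Suc n < norm (T (x n))" by metis
    have "(\<lambda>n. M - 1 / Suc n) \<longlonglongrightarrow> M - 0"
      by (intro tendsto_intros LIMSEQ_Suc[OF lim_1_over_n])
    then have low: "(\<lambda>n. M - 1 / Suc n) \<longlonglongrightarrow> M" by simp
    have lim: "(\<lambda>n. norm (T (x n))) \<longlonglongrightarrow> M"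
      by (rule tendsto_sandwich[OF _ _ low tendsto_const]) (use xM MS[OF xS] in \<open>auto intro!: always_eventually less_imp_le\<close>)
    have "compact (closure (T ` cball 0 1))" using T by (simp add: compact_qlinear_def)
    moreover have "T (x n) \<in> closure (T ` cball 0 1)" for n
      using xS[of n] by (intro subsetD[OF closure_subset]) (simp add: S_def)
    ultimately obtain l r where r: "strict_mono (r :: nat \<Rightarrow> nat)" and l: "((\<lambda>n. T (x n)) \<circ> r) \<longlonglongrightarrow> l"
      unfolding compact_def by meson
    have Bl: "(\<lambda>n. ?B (x (r n))) \<longlonglongrightarrow> qadjoint T l"
      using bounded_linear.tendsto[OF blA l] by (simp add: o_def)
    \<comment> \<open>Nearly maximal vectors are nearly eigenvectors. Since \<open>?B y\<close>
      stays in \<open>V\<close>, the bound \<open>MV\<close> applies to it too and gives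
      \<open>norm (?B y) \<le> M^2\<close>; the cross term of the expanded square is
      \<open>M^2 * (norm (T y))^2\<close>.\<close>
    have est: "(norm (?B y - M\<^sup>2 *\<^sub>R y))\<^sup>2 \<le> 2 * M\<^sup>2 * (M\<^sup>2 - (norm (T y))\<^sup>2)" if y: "y \<in> S" for y
    proof -
      have yV: "y \<in> V" and ny: "norm y = 1" using y by (auto simp: S_def)
      have "(norm (?B y))\<^sup>2 = qRe (qinner (?B y) (?B y))" by (simp add: qinner_self)
      also have "\<dots> = qRe (qinner (T y) (T (?B y)))" by (simp only: qinner_qadjoint[OF bq])
      also have "\<dots> \<le> norm (T y) * norm (T (?B y))" by (meson norm_qinner_le order_trans qRe_le_norm)
      also have "\<dots> \<le> M * (M * norm (?B y))" by (intro mult_mono MS y MV inv yV M0) simp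
      finally have "norm (?B y) \<le> M\<^sup>2" by (cases "?B y = 0") (simp_all add: power2_eq_square mult.assoc)
      then have "(norm (?B y))\<^sup>2 \<le> (M\<^sup>2)\<^sup>2" by (intro power_mono) simp_all
      moreover have "qRe (qinner (?B y) (M\<^sup>2 *\<^sub>R y)) = M\<^sup>2 * (norm (T y))\<^sup>2"
        by (simp add: qinner_scaleR_right qinner_qadjoint[OF bq] qinner_self)
      ultimately show ?thesis
        unfolding norm_sq_diff by (simp add: ny algebra_simps power2_eq_square)
    qed
    have "(\<lambda>n. 2 * M\<^sup>2 * (M\<^sup>2 - (norm (T (x (r n))))\<^sup>2)) \<longlonglongrightarrow> 2 * M\<^sup>2 * (M\<^sup>2 - M\<^sup>2)"
      using LIMSEQ_subseq_LIMSEQ[OF lim r] by (intro tendsto_intros) (simp add: o_def)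
    then have up: "(\<lambda>n. 2 * M\<^sup>2 * (M\<^sup>2 - (norm (T (x (r n))))\<^sup>2)) \<longlonglongrightarrow> 0" by simp
    have "(\<lambda>n. (norm (?B (x (r n)) - M\<^sup>2 *\<^sub>R x (r n)))\<^sup>2) \<longlonglongrightarrow> 0"
      by (rule tendsto_sandwich[OF _ _ tendsto_const up]) (intro always_eventually allI zero_le_power2 est xS)+
    from tendsto_real_sqrt[OF this] have "(\<lambda>n. norm (?B (x (r n)) - M\<^sup>2 *\<^sub>R x (r n))) \<longlonglongrightarrow> 0"
      by simp
    then have "(\<lambda>n. ?B (x (r n)) - M\<^sup>2 *\<^sub>R x (r n)) \<longlonglongrightarrow> 0"
      by (rule tendsto_norm_zero_cancel)
    \<comment> \<open>The images under \<open>?B\<close> converge and differ from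
      \<open>M^2 *\<^sub>R x (r n)\<close> by a null sequence; dividing by \<open>M^2 > 0\<close>
      gives the limit of the vectors.\<close>
    from tendsto_diff[OF Bl this] have "(\<lambda>n. M\<^sup>2 *\<^sub>R x (r n)) \<longlonglongrightarrow> qadjoint T l" by simp
    from tendsto_scaleR[OF tendsto_const[of "1 / M\<^sup>2"] this]
    have z: "(\<lambda>n. x (r n)) \<longlonglongrightarrow> (1 / M\<^sup>2) *\<^sub>R qadjoint T l" (is "_ \<longlonglongrightarrow> ?z") using M by simp
    have "?z \<in> V" by (rule closed_sequentially[OF V(2) _ z]) (use xS in \<open>auto simp: S_def\<close>)
    moreover have "norm ?z = 1"
      by (rule LIMSEQ_unique[OF tendsto_norm[OF z]]) (use xS in \<open>simp add: S_def\<close>)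
    then have "?z \<noteq> 0" by (metis norm_zero zero_neq_one)
    moreover have "?B ?z = M\<^sup>2 *\<^sub>R ?z"
      using LIMSEQ_unique[OF bounded_linear.tendsto[OF blA bounded_linear.tendsto[OF bl z]] Bl] M by simp
    ultimately show ?thesis by blast
  qed
qed

text \<open>The map sending \<open>v\<close> to \<open>v - J v \<cdot>\<^sub>q i\<close> is twice
  the projection onto the slice of \<open>i\<close> along the slice of \<open>- i\<close>, and it
  preserves \<open>V\<close>.\<close>

lemma plus_slice_meets_invariant:
  assumes J: "bounded_qlinear J" "\<And>x. J (J x) = - x" and i: "i \<in> imaginary_units"
    and V: "qsubspace V" "\<And>x. x \<in> V \<Longrightarrow> J x \<in> V" and v: "v \<in> V" "v \<noteq> 0"
  shows "\<exists>x\<in>V. x \<in> plus_slice J i \<and> norm x = 1"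
proof -
  have "\<exists>x\<in>V. x \<in> plus_slice J i \<and> x \<noteq> 0"
  proof (cases "v - J v \<cdot>\<^sub>q i = 0")
    case False
    have "J (v - J v \<cdot>\<^sub>q i) = (v - J v \<cdot>\<^sub>q i) \<cdot>\<^sub>q i"
      by (simp add: bounded_qlinearD[OF J(1)] J(2) rscale_diff_left rscale_minus_left rscale_minus_right
          imaginary_units_square[OF i] rscale_one flip: rscale_mult)
    moreover have "v - J v \<cdot>\<^sub>q i \<in> V"
      using V v by (intro qsubspace_diff) (auto simp: qsubspace_def)
    ultimately show ?thesis using False by (intro bexI[of _ "v - J v \<cdot>\<^sub>q i"]) (simp_all add: plus_slice_def)
  next
    case True
    \<comment> \<open>Here \<open>v\<close> lies in the slice of \<open>- i\<close>, and right
      multiplication by a quaternion anticommuting with \<open>i\<close> carries it into the slice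
      of \<open>i\<close>.\<close>
    then have vJ: "J v \<cdot>\<^sub>q i = v" by simp
    then have "(J v \<cdot>\<^sub>q i) \<cdot>\<^sub>q i = v \<cdot>\<^sub>q i" by simp
    then have Jv: "J v = - (v \<cdot>\<^sub>q i)"
      by (simp add: imaginary_units_square[OF i] rscale_minus_right rscale_one flip: rscale_mult)
         (metis add.inverse_inverse)
    obtain j where j: "j \<noteq> 0" "j * i = - (i * j)" using ex_anticommuting_quat[OF i] by blast
    have "J (v \<cdot>\<^sub>q j) = (v \<cdot>\<^sub>q j) \<cdot>\<^sub>q i"
      by (simp add: bounded_qlinearD[OF J(1)] Jv rscale_minus_left rscale_minus_right j flip: rscale_mult)
    moreover have "norm (v \<cdot>\<^sub>q j) \<noteq> 0" using v j by (simp add: norm_rscale)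
    moreover have "v \<cdot>\<^sub>q j \<in> V" using V v by (simp add: qsubspace_def)
    ultimately show ?thesis by (intro bexI[of _ "v \<cdot>\<^sub>q j"]) (auto simp: plus_slice_def)
  qed
  then obtain x where x: "x \<in> V" "J x = x \<cdot>\<^sub>q i" "x \<noteq> 0" by (auto simp: plus_slice_def)
  let ?y = "(1 / norm x) *\<^sub>R x"
  have "J ?y = ?y \<cdot>\<^sub>q i" by (simp add: bounded_qlinearD[OF J(1)] x scaleR_rscale)
  then show ?thesis using x V
    by (intro bexI[of _ ?y]) (simp_all add: plus_slice_def qsubspace_scaleR)
qed

text \<open>The eigenvalue of a unit eigenvector \<open>e\<close> is necessarily
  \<open>(norm (T e))^2\<close>; spelling it out makes \<open>norm (T e)\<close> the singular value
  attached to \<open>e\<close>.\<close>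

definition right_singular_basis :: "('a::quaternionic_hilbert \<Rightarrow> 'a) \<Rightarrow> 'a set \<Rightarrow> bool" where
  "right_singular_basis T E \<longleftrightarrow>
     qcomplete E \<and> (\<forall>e\<in>E. qadjoint T (T e) = (norm (T e))\<^sup>2 *\<^sub>R e)"

text \<open>The orthogonal complement \<open>V\<close> of a maximal orthonormal set of eigenvectors
  in the slice is closed and invariant under \<open>?B\<close> and \<open>J\<close>. Were it
  nonzero, it would contain an eigenvector, and the eigenspace of that eigenvector within
  \<open>V\<close> would meet the slice, against maximality.\<close>

lemma ex_right_singular_basis_in_plus_slice:
  fixes T J :: "'a::quaternionic_hilbert \<Rightarrow> 'a"
  assumes J: "bounded_qlinear J" "anti_selfadjoint J" "qunitary J" and i: "i \<in> imaginary_units"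
    and T: "compact_qlinear T" and comm: "commutator T J = (\<lambda>x. 0)"
  shows "\<exists>E. right_singular_basis T E \<and> E \<subseteq> plus_slice J i"
proof -
  have bq: "bounded_qlinear T" using T by (simp add: compact_qlinear_def)
  let ?B = "\<lambda>x. qadjoint T (T x)"
  have Bq: "bounded_qlinear ?B"
    using bounded_qlinear_comp[OF bounded_qlinear_qadjoint[OF bq] bq] by (simp add: o_def)
  have Jadj: "qadjoint J = (\<lambda>x. - J x)" using J(2) by (simp add: anti_selfadjoint_def)
  have Jsq: "J (J x) = - x" for x
  proof -
    have "(qadjoint J \<circ> J) x = x" using J(3) by (simp add: qunitary_def)
    then show ?thesis by (simp add: Jadj) (metis add.inverse_inverse)
  qed
  have Jin: "qinner x (J y) = - qinner (J x) y" for x y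
    using qinner_qadjoint[OF J(1), of x y] by (simp add: Jadj qinner_minus_left)
  have TJ: "T (J x) = J (T x)" for x
    using fun_cong[OF comm, of x] by (simp add: commutator_def)
  \<comment> \<open>Since the adjoint of \<open>J\<close> is \<open>- J\<close>, taking adjoints in
    \<open>T J = J T\<close> changes the sign on both sides.\<close>
  have AJ: "qadjoint T (J x) = J (qadjoint T x)" for x
  proof (rule qinner_eqI)
    fix y
    have "qinner (J (qadjoint T x)) y = - qinner (qadjoint T x) (J y)" by (simp only: Jin minus_minus)
    also have "\<dots> = qinner (J x) (T y)" by (subst qinner_qadjoint[OF bq]) (simp only: TJ Jin minus_minus)
    finally show "qinner (qadjoint T (J x)) y = qinner (J (qadjoint T x)) y"
      by (simp add: qinner_qadjoint[OF bq])
  qed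
  have Bin: "qinner x (?B y) = qinner (?B x) y" for x y
    by (simp add: qinner_qadjoint[OF bq] qinner_qadjoint_right[OF bq])
  obtain E where E: "qorthonormal E" "\<forall>e\<in>E. e \<in> plus_slice J i \<and> (\<exists>\<mu>. ?B e = \<mu> *\<^sub>R e)"
    and max: "\<And>x. norm x = 1 \<Longrightarrow> x \<in> plus_slice J i \<and> (\<exists>\<mu>. ?B x = \<mu> *\<^sub>R x) \<Longrightarrow>
                  \<forall>e\<in>E. qinner e x = 0 \<Longrightarrow> False"
    using ex_maximal_orthonormal[of "\<lambda>x. x \<in> plus_slice J i \<and> (\<exists>\<mu>. ?B x = \<mu> *\<^sub>R x)"] by blast
  define V where "V = {x. \<forall>e\<in>E. qinner e x = 0}"
  have V: "qsubspace V" unfolding V_def qsubspace_def by (auto simp: qinner_add_right qinner_rscale_right)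
  have "V = (\<Inter>e\<in>E. {x. qinner e x = 0})" by (auto simp: V_def)
  then have Vc: "closed V"
    by (simp only:) (intro closed_INT ballI closed_Collect_eq continuous_on_const
        linear_continuous_on bounded_linear_qinner_right)
  have VB: "?B x \<in> V" if "x \<in> V" for x
  proof -
    have "qinner e (?B x) = 0" if e: "e \<in> E" for e
    proof -
      obtain \<mu> where "?B e = \<mu> *\<^sub>R e" using bspec[OF E(2) e] by blast
      then show ?thesis using \<open>x \<in> V\<close> e unfolding Bin by (simp add: qinner_scaleR_left V_def)
    qed
    then show ?thesis by (simp add: V_def)
  qed
  have VJ: "J x \<in> V" if "x \<in> V" for x
    using that E(2) unfolding V_def by (auto simp: Jin plus_slice_def qinner_rscale_left)
  have "x = 0" if "\<forall>e\<in>E. qinner e x = 0" for x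
  proof (rule ccontr)
    assume "x \<noteq> 0"
    moreover have "x \<in> V" using that by (simp add: V_def)
    ultimately obtain y \<mu> where y: "y \<in> V" "y \<noteq> 0" "?B y = \<mu> *\<^sub>R y"
      using compact_ex_top_eigenvector[OF T V Vc VB] by blast
    define W where "W = {x \<in> V. ?B x = \<mu> *\<^sub>R x}"
    have W: "qsubspace W"
      using V unfolding W_def qsubspace_def
      by (auto simp: bounded_qlinearD[OF Bq] scaleR_add_right scaleR_rscale)
    \<comment> \<open>The vector \<open>y\<close> itself need not lie in the slice, so the whole
      eigenspace is used: it is invariant under \<open>J\<close> because \<open>?B\<close> commutes
      with \<open>J\<close>.\<close>
    have WJ: "J x \<in> W" if "x \<in> W" for x
      using that VJ by (auto simp: W_def TJ AJ bounded_qlinearD[OF J(1)])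
    have "y \<in> W" using y by (simp add: W_def)
    from plus_slice_meets_invariant[OF J(1) Jsq i W WJ this y(2)]
    obtain z where "z \<in> W" "z \<in> plus_slice J i" "norm z = 1" by blast
    then show False using max[of z] by (auto simp: W_def V_def)
  qed
  then have "qcomplete E" using E by (auto simp: qcomplete_def)
  moreover have "?B e = (norm (T e))\<^sup>2 *\<^sub>R e" if e: "e \<in> E" for e
  proof -
    obtain \<mu> where \<mu>: "?B e = \<mu> *\<^sub>R e" using bspec[OF E(2) e] by blast
    have "qinner e (?B e) = of_real ((norm (T e))\<^sup>2)"
      by (simp only: qinner_qadjoint_right[OF bq] qinner_self)
    moreover have "qinner e (?B e) = of_real \<mu>"
      unfolding \<mu> by (simp add: qinner_scaleR_right qinner_self qorthonormal_norm[OF E(1) e] scaleR_conv_of_real)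
    ultimately show ?thesis using \<mu> of_real_eq_iff by metis
  qed
  ultimately show ?thesis using E(2) unfolding right_singular_basis_def by blast
qed

text \<open>Distinct basis vectors have orthogonal images, as \<open>T e\<close> paired with
  \<open>T f\<close> equals \<open>(norm (T e))^2\<close> times the product of \<open>e\<close> and
  \<open>f\<close>. Infinitely many images of norm at least \<open>\<delta>\<close> would have
  mutual distance at least \<open>\<delta>\<close>, hence no convergent subsequence.\<close>

lemma finite_large_norm_right_singular_basis:
  fixes T :: "'a::quaternionic_hilbert \<Rightarrow> 'a"
  assumes T: "compact_qlinear T" and E: "right_singular_basis T E" and \<delta>: "\<delta> > 0"
  shows "finite {e \<in> E. norm (T e) \<ge> \<delta>}"
proof (rule ccontr)
  have bq: "bounded_qlinear T" using T by (simp add: compact_qlinear_def)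
  have on: "qorthonormal E" using E by (simp add: right_singular_basis_def qcomplete_def)
  assume "infinite {e \<in> E. norm (T e) \<ge> \<delta>}"
  then obtain x :: "nat \<Rightarrow> 'a" where inj: "inj x" and x: "range x \<subseteq> {e \<in> E. norm (T e) \<ge> \<delta>}"
    using infinite_countable_subset by blast
  have "compact (closure (T ` cball 0 1))" using T by (simp add: compact_qlinear_def)
  moreover have "T (x n) \<in> closure (T ` cball 0 1)" for n
  proof -
    have "x n \<in> E" using x by auto
    then have "x n \<in> cball 0 1" using qorthonormal_norm[OF on] by simp
    then show ?thesis by (intro subsetD[OF closure_subset]) blast
  qed
  ultimately obtain l r where r: "strict_mono (r :: nat \<Rightarrow> nat)" and l: "((\<lambda>n. T (x n)) \<circ> r) \<longlonglongrightarrow> l"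
    unfolding compact_def by meson
  then obtain N where N: "\<And>m n. m \<ge> N \<Longrightarrow> n \<ge> N \<Longrightarrow> dist (T (x (r m))) (T (x (r n))) < \<delta>"
    using LIMSEQ_imp_Cauchy[OF l] \<delta> unfolding Cauchy_def o_def by meson
  let ?e = "x (r N)" and ?f = "x (r (Suc N))"
  have ne: "?e \<noteq> ?f" using inj r by (simp add: inj_eq strict_mono_eq)
  have ef: "?e \<in> E" "?f \<in> E" "norm (T ?e) \<ge> \<delta>" using x by auto
  have "qinner (T ?e) (T ?f) = qinner (qadjoint T (T ?e)) ?f" by (simp add: qinner_qadjoint[OF bq])
  also have "\<dots> = 0"
    using E ef ne on by (simp add: right_singular_basis_def qinner_scaleR_left qorthonormal_def)
  finally have "(norm (T ?e - T ?f))\<^sup>2 = (norm (T ?e))\<^sup>2 + (norm (T ?f))\<^sup>2" by (simp add: norm_sq_diff)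
  then have "(norm (T ?e))\<^sup>2 \<le> (norm (T ?e - T ?f))\<^sup>2" by simp
  then have "norm (T ?e) \<le> norm (T ?e - T ?f)" by (rule power2_le_imp_le) simp
  with N[of N "Suc N"] ef show False by (simp add: dist_norm)
qed

section \<open>The absolute value\<close>

lemma qcomplete_eqI:
  assumes "qcomplete E" "\<And>e. e \<in> E \<Longrightarrow> qinner e x = qinner e y"
  shows "x = y"
proof -
  have "x - y = 0" using assms unfolding qcomplete_def by (metis eq_iff_diff_eq_0 qinner_diff_right)
  then show ?thesis by simp
qed

text \<open>The operator multiplies the coefficient at \<open>e\<close> by \<open>m e\<close>.
  Parseval bounds it, and linearity is checked coefficient by coefficient.\<close>

lemma ex_diagonal_operator:
  fixes E :: "'a::quaternionic_hilbert set" and m :: "'a \<Rightarrow> real"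
  assumes E: "qcomplete E" and m: "\<And>e. e \<in> E \<Longrightarrow> 0 \<le> m e" "\<And>e. e \<in> E \<Longrightarrow> m e \<le> K"
  shows "\<exists>A. qpositive A \<and> (\<forall>e\<in>E. A e = m e *\<^sub>R e)"
proof -
  have on: "qorthonormal E" using E by (simp add: qcomplete_def)
  let ?c = "\<lambda>x e. of_real (m e) * qinner e x"
  have le: "(norm (?c x e))\<^sup>2 \<le> K\<^sup>2 * (norm (qinner e x))\<^sup>2" if "e \<in> E" for x e
    using m[OF that] by (auto simp: norm_mult power_mult_distrib intro!: mult_right_mono power_mono)
  have Ks: "((\<lambda>e. K\<^sup>2 * (norm (qinner e x))\<^sup>2) has_sum K\<^sup>2 * (norm x)\<^sup>2) E" for x
    by (intro has_sum_cmult_right Parseval E)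
  have "(\<lambda>e. (norm (?c x e))\<^sup>2) summable_on E" for x
    by (rule summable_on_comparison_test[OF has_sum_imp_summable[OF Ks[of x]]]) (auto intro: le)
  then have "(\<lambda>e. e \<cdot>\<^sub>q ?c x e) summable_on E" for x by (rule orthonormal_summable[OF on])
  then obtain A where A: "\<And>x. ((\<lambda>e. e \<cdot>\<^sub>q ?c x e) has_sum A x) E"
    unfolding summable_on_def by metis
  have Ain: "qinner e (A x) = ?c x e" if "e \<in> E" for e x
    using orthonormal_has_sum(1)[OF on A that] .
  \<comment> \<open>The absolute value matters when \<open>E\<close> is empty, since then nothing
    forces \<open>K\<close> to be nonnegative.\<close>
  have "norm (A x) \<le> norm x * \<bar>K\<bar>" for x
  proof -
    have "(norm (A x))\<^sup>2 \<le> K\<^sup>2 * (norm x)\<^sup>2"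
      by (rule has_sum_mono[OF orthonormal_has_sum(2)[OF on A] Ks]) (rule le)
    also have "\<dots> = (norm x * \<bar>K\<bar>)\<^sup>2" by (simp add: power_mult_distrib)
    finally show ?thesis by (rule power2_le_imp_le) simp
  qed
  then have "bounded_linear A"
    by (intro bounded_linear_intro qcomplete_eqI[OF E])
       (auto simp: Ain qinner_add_right qinner_scaleR_right algebra_simps)
  moreover have "A (x \<cdot>\<^sub>q a) = A x \<cdot>\<^sub>q a" for x a
    by (intro qcomplete_eqI[OF E]) (simp add: Ain qinner_rscale_right mult.assoc)
  ultimately have Abq: "bounded_qlinear A" by (simp add: bounded_qlinear_def)
  have "\<exists>r\<ge>0. qinner x (A x) = of_real r" for x
  proof -
    have "(\<lambda>e. m e * (norm (qinner e x))\<^sup>2) summable_on E"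
      by (rule summable_on_comparison_test[OF summable_on_cmult_right[OF has_sum_imp_summable[OF Parseval[OF E]], of K x]])
         (auto intro!: mult_right_mono mult_nonneg_nonneg m)
    then obtain r where r: "((\<lambda>e. m e * (norm (qinner e x))\<^sup>2) has_sum r) E" by (auto simp: summable_on_def)
    then have "((\<lambda>e. of_real (m e * (norm (qinner e x))\<^sup>2)) has_sum (of_real r :: quat)) E"
      by (rule has_sum_bounded_linear[OF bounded_linear_of_real])
    moreover have "((\<lambda>e. qinner x (e \<cdot>\<^sub>q ?c x e)) has_sum qinner x (A x)) E"
      by (rule has_sum_bounded_linear[OF bounded_linear_qinner_right A])
    moreover have "qinner x (e \<cdot>\<^sub>q ?c x e) = of_real (m e * (norm (qinner e x))\<^sup>2)" for e
      unfolding qinner_rscale_right qinner_cnj[of x e] of_real_mult qcnj_mult_self[symmetric]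
      by (simp only: quat_of_real_commute[symmetric, of _ "qcnj (qinner e x)"] mult.assoc[symmetric])
    ultimately have "qinner x (A x) = of_real r" using has_sum_unique by fastforce
    moreover have "r \<ge> 0" using has_sum_nonneg[OF r] m by simp
    ultimately show ?thesis by blast
  qed
  then have "qpositive A" using Abq by (auto simp: qpositive_def)
  moreover have "A e = m e *\<^sub>R e" if e: "e \<in> E" for e
    using on e by (intro qcomplete_eqI[OF E])
      (simp add: Ain qinner_scaleR_right qorthonormal_def scaleR_conv_of_real)
  ultimately show ?thesis by blast
qed

text \<open>For \<open>\<mu> > 0\<close> the vector \<open>A e - \<mu> *\<^sub>R e\<close> is an
  eigenvector for \<open>- \<mu>\<close> or zero, and positivity excludes the former. For
  \<open>\<mu> = 0\<close> the form evaluated at \<open>e + t *\<^sub>R A e\<close> is affine in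
  \<open>t\<close> with slope \<open>(norm (A e))^2\<close>, and stays nonnegative only if the slope
  is zero.\<close>

lemma qpositive_square_root_eigenvector:
  assumes A: "qpositive A" and e: "A (A e) = \<mu>\<^sup>2 *\<^sub>R e" and \<mu>: "\<mu> \<ge> 0"
  shows "A e = \<mu> *\<^sub>R e"
proof -
  have bq: "bounded_qlinear A" using A by (simp add: qpositive_def)
  have pos: "qRe (qinner x (A x)) \<ge> 0" for x
  proof -
    obtain r where "r \<ge> 0" "qinner x (A x) = of_real r" using A unfolding qpositive_def by blast
    then show ?thesis by simp
  qed
  show ?thesis
  proof (cases "\<mu> = 0")
    case False
    let ?y = "A e - \<mu> *\<^sub>R e"
    have "A ?y = - (\<mu> *\<^sub>R ?y)" by (simp add: bounded_qlinearD[OF bq] e power2_eq_square algebra_simps)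
    then have "qRe (qinner ?y (A ?y)) = - (\<mu> * (norm ?y)\<^sup>2)"
      by (simp only: qinner_minus_right qinner_scaleR_right) (simp add: qinner_self)
    then have "\<mu> * (norm ?y)\<^sup>2 \<le> 0" using pos[of ?y] by linarith
    then have "(norm ?y)\<^sup>2 \<le> 0" using False \<mu> by (simp add: mult_le_0_iff)
    then show ?thesis by simp
  next
    case True
    let ?y = "A e"
    have Ay: "A ?y = 0" using e True by simp
    let ?a = "qRe (qinner e ?y)" and ?b = "(norm ?y)\<^sup>2"
    have t: "0 \<le> ?a + t * ?b" for t
    proof -
      have "qinner (e + t *\<^sub>R ?y) (A (e + t *\<^sub>R ?y)) = qinner e ?y + t *\<^sub>R of_real ?b"
        by (simp add: bounded_qlinearD[OF bq] Ay qinner_add_left qinner_scaleR_left qinner_self)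
      then show ?thesis using pos[of "e + t *\<^sub>R ?y"] by simp
    qed
    have "?b = 0"
    proof (rule ccontr)
      assume "?b \<noteq> 0"
      \<comment> \<open>This value of \<open>t\<close> makes the affine function equal to
        \<open>- 1\<close>.\<close>
      then show False using t[of "- (?a + 1) / ?b"] by simp
    qed
    then show ?thesis using True by simp
  qed
qed

text \<open>The diagonal operator with entries \<open>norm (T e)\<close> is a positive square root
  of \<open>T* T\<close>. Any other one agrees with it on the basis, so the definite description in
  \<open>op_abs\<close> denotes it.\<close>

lemma op_abs_right_singular_basis:
  assumes bq: "bounded_qlinear T" and E: "right_singular_basis T E"
  shows "qpositive (op_abs T)" and "\<And>e. e \<in> E \<Longrightarrow> op_abs T e = norm (T e) *\<^sub>R e"
proof -
  have cE: "qcomplete E" and B: "\<And>e. e \<in> E \<Longrightarrow> qadjoint T (T e) = (norm (T e))\<^sup>2 *\<^sub>R e"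
    using E by (auto simp: right_singular_basis_def)
  have on: "qorthonormal E" using cE by (simp add: qcomplete_def)
  have "norm (T e) \<le> onorm T" if "e \<in> E" for e
    using onorm[OF bounded_qlinearD(1)[OF bq], of e] qorthonormal_norm[OF on that] by simp
  then obtain A where A: "qpositive A" and Ae: "\<And>e. e \<in> E \<Longrightarrow> A e = norm (T e) *\<^sub>R e"
    using ex_diagonal_operator[OF cE, of "\<lambda>e. norm (T e)" "onorm T"] by auto
  have bA: "bounded_qlinear A" using A by (simp add: qpositive_def)
  have "op_abs T = A" unfolding op_abs_def
  proof (rule the_equality)
    have "A \<circ> A = qadjoint T \<circ> T"
      by (rule bounded_qlinear_eqI[OF cE])
         (auto simp: Ae B bounded_qlinearD(7)[OF bA] power2_eq_square
           intro!: bounded_qlinear_comp bounded_qlinear_qadjoint bA bq)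
    then show "qpositive A \<and> A \<circ> A = qadjoint T \<circ> T" using A by simp
    fix A' assume A': "qpositive A' \<and> A' \<circ> A' = qadjoint T \<circ> T"
    then have pos: "qpositive A'" and sq: "A' \<circ> A' = qadjoint T \<circ> T" by blast+
    show "A' = A"
    proof (rule bounded_qlinear_eqI[OF cE _ bA])
      show "bounded_qlinear A'" using pos by (simp add: qpositive_def)
      show "A' e = A e" if "e \<in> E" for e
      proof -
        have "A' (A' e) = (norm (T e))\<^sup>2 *\<^sub>R e" using fun_cong[OF sq, of e] B[OF that] by simp
        then show ?thesis
          unfolding Ae[OF that] by (rule qpositive_square_root_eigenvector[OF pos _ norm_ge_zero])
      qed
    qed
  qed
  then show "qpositive (op_abs T)" "\<And>e. e \<in> E \<Longrightarrow> op_abs T e = norm (T e) *\<^sub>R e"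
    using A Ae by auto
qed

section \<open>Dimension over the quaternions\<close>

lemma qsubspace_qspan: "qsubspace (qspan S)"
  unfolding qspan_def by (rule hull_in) (auto simp: qsubspace_def)

lemma qspan_superset: "S \<subseteq> qspan S"
  unfolding qspan_def by (rule hull_subset)

lemma qspan_minimal: "S \<subseteq> V \<Longrightarrow> qsubspace V \<Longrightarrow> qspan S \<subseteq> V"
  unfolding qspan_def by (rule hull_minimal)

lemma rscale_mem_qsubspace_iff:
  assumes "qsubspace V" "a \<noteq> 0"
  shows "x \<cdot>\<^sub>q a \<in> V \<longleftrightarrow> x \<in> V"
proof
  assume "x \<cdot>\<^sub>q a \<in> V"
  then have "(x \<cdot>\<^sub>q a) \<cdot>\<^sub>q inverse a \<in> V" using assms by (simp add: qsubspace_def)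
  then show "x \<in> V" using assms by (simp add: rscale_one flip: rscale_mult)
qed (use assms in \<open>simp add: qsubspace_def\<close>)

text \<open>
  The dimension theory of the library needs a commutative field, so bases are compared over the reals:
  a quaternionic basis \<open>B\<close> yields the real basis of all \<open>b \<cdot>\<^sub>q u\<close> with \<open>b \<in> B\<close> and \<open>u\<close> one of the four units.
\<close>

definition quat_units :: "quat set" where
  "quat_units = {1, Quat 0 1 0 0, Quat 0 0 1 0, Quat 0 0 0 1}"

lemma quat_units_inner: "u \<in> quat_units \<Longrightarrow> v \<in> quat_units \<Longrightarrow> inner u v = (if u = v then 1 else 0)"
  by (auto simp: quat_units_def inner_quat_def quat_eq_iff)

lemma card_quat_units: "card quat_units = 4"
  by (simp add: quat_units_def quat_eq_iff)

lemma quat_expand: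
  "q = qRe q *\<^sub>R 1 + qIm1 q *\<^sub>R Quat 0 1 0 0 + qIm2 q *\<^sub>R Quat 0 0 1 0 + qIm3 q *\<^sub>R Quat 0 0 0 1"
  by (simp add: quat_eq_iff)

definition realify :: "'a::quaternionic_vector set \<Rightarrow> 'a set" where
  "realify B = (\<lambda>(b, u). b \<cdot>\<^sub>q u) ` (B \<times> quat_units)"

lemma span_realify:
  fixes B :: "'a::quaternionic_vector set"
  shows "span (realify B) = qspan B"
proof
  have "subspace (qspan B)"
    using qsubspace_qspan[of B] by (auto simp: subspace_def qsubspace_def scaleR_eq_rscale)
  moreover have "realify B \<subseteq> qspan B"
    using qsubspace_qspan[of B] qspan_superset[of B] by (auto simp: realify_def qsubspace_def)
  ultimately show "span (realify B) \<subseteq> qspan B" by (rule span_minimal[rotated])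
  have base: "b \<cdot>\<^sub>q q \<in> span (realify B)" if "b \<in> B" for b q
  proof -
    have "b \<cdot>\<^sub>q u \<in> span (realify B)" if "u \<in> quat_units" for u
      using that \<open>b \<in> B\<close> by (intro span_base) (auto simp: realify_def)
    then have "b \<cdot>\<^sub>q (r *\<^sub>R u) \<in> span (realify B)" if "u \<in> quat_units" for u r
      using that by (simp add: rscale_scaleR span_scale)
    then show ?thesis
      by (subst quat_expand, unfold rscale_add_right, intro span_add) (auto simp: quat_units_def)
  qed
  have "x \<cdot>\<^sub>q a \<in> span (realify B)" if "x \<in> span (realify B)" for x a
    using that
  proof (induction rule: span_induct_alt)
    case base show ?case by (simp add: span_zero)
  next
    case (step c y z)
    then obtain b u where "b \<in> B" "y = b \<cdot>\<^sub>q u" by (auto simp: realify_def)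
    then have "y \<cdot>\<^sub>q a \<in> span (realify B)" using base[of b "u * a"] by (simp add: rscale_mult)
    then show ?case using step by (simp add: rscale_add_left scaleR_rscale span_add span_scale)
  qed
  then have "qsubspace (span (realify B))" by (auto simp: qsubspace_def span_zero span_add)
  moreover have "B \<subseteq> span (realify B)" using base[of _ 1] by (auto simp: rscale_one)
  ultimately show "qspan B \<subseteq> span (realify B)" by (rule qspan_minimal[rotated])
qed

text \<open>This makes \<open>realify B\<close> four times as large as \<open>B\<close>. A
  coincidence between different \<open>b\<close> and \<open>b'\<close>, or between different units
  at the same \<open>b\<close>, would put \<open>b\<close> into the span of the other elements after
  dividing by a nonzero quaternion.\<close>

lemma inj_on_realify:
  assumes "qindependent B"
  shows "inj_on (\<lambda>(b, u). b \<cdot>\<^sub>q u) (B \<times> quat_units)"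
proof (rule inj_onI, clarify)
  fix b u b' v assume B: "b \<in> B" "b' \<in> B" and U: "u \<in> quat_units" "v \<in> quat_units"
    and eq: "b \<cdot>\<^sub>q u = b' \<cdot>\<^sub>q v"
  have b: "b \<notin> qspan (B - {b})" using assms B by (simp add: qindependent_def)
  have nz: "u \<noteq> 0" using quat_units_inner[OF U(1) U(1)] by auto
  have "b = b'"
  proof (rule ccontr)
    assume "b \<noteq> b'"
    then have "b' \<in> qspan (B - {b})" using B subsetD[OF qspan_superset, of b' "B - {b}"] by simp
    then have "b \<cdot>\<^sub>q u \<in> qspan (B - {b})" using qsubspace_qspan[of "B - {b}"] by (auto simp: eq qsubspace_def)
    then show False using rscale_mem_qsubspace_iff[OF qsubspace_qspan nz] b by blast
  qed
  moreover have "u = v"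
  proof (rule ccontr)
    assume "u \<noteq> v"
    then have "u - v \<noteq> 0" by simp
    moreover have "b \<cdot>\<^sub>q (u - v) = 0" using eq \<open>b = b'\<close> by (simp add: rscale_diff_right)
    then have "b \<cdot>\<^sub>q (u - v) \<in> qspan (B - {b})" using qsubspace_qspan by (auto simp: qsubspace_def)
    ultimately show False using rscale_mem_qsubspace_iff[OF qsubspace_qspan] b by blast
  qed
  ultimately show "b = b' \<and> u = v" by simp
qed

lemma independent_realify:
  fixes B :: "'a::quaternionic_vector set"
  assumes ind: "qindependent B"
  shows "independent (realify B)"
proof
  assume "dependent (realify B)"
  then obtain b u where B: "b \<in> B" and u: "u \<in> quat_units"
    and bu: "b \<cdot>\<^sub>q u \<in> span (realify B - {b \<cdot>\<^sub>q u})"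
    by (auto simp: dependent_def realify_def)
  \<comment> \<open>A real subspace containing every generator except
    \<open>b \<cdot>\<^sub>q u\<close>: the component along \<open>b\<close> may use only
    quaternions orthogonal to \<open>u\<close>. If it also contained
    \<open>b \<cdot>\<^sub>q u\<close>, then \<open>b \<cdot>\<^sub>q (u - q)\<close> with
    \<open>u - q \<noteq> 0\<close> would lie in the span of the other elements.\<close>
  define W where "W = {y + b \<cdot>\<^sub>q q | y q. y \<in> qspan (B - {b}) \<and> inner q u = 0}"
  note qs = qsubspace_qspan[of "B - {b}"]
  have "subspace W" unfolding subspace_def
  proof (intro conjI ballI allI)
    show "0 \<in> W" using qs unfolding W_def qsubspace_def by (auto intro!: exI[of _ 0])
    show "x + y \<in> W" if "x \<in> W" "y \<in> W" for x y
    proof -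
      from that obtain x1 q y1 r where "x1 \<in> qspan (B - {b})" "inner q u = 0" "x = x1 + b \<cdot>\<^sub>q q"
        "y1 \<in> qspan (B - {b})" "inner r u = 0" "y = y1 + b \<cdot>\<^sub>q r" unfolding W_def by blast
      then show ?thesis using qs unfolding W_def qsubspace_def
        by (intro CollectI exI[of _ "x1 + y1"] exI[of _ "q + r"])
           (auto simp: rscale_add_right inner_add_left)
    qed
    show "c *\<^sub>R x \<in> W" if "x \<in> W" for c x
    proof -
      from that obtain x1 q where "x1 \<in> qspan (B - {b})" "inner q u = 0" "x = x1 + b \<cdot>\<^sub>q q"
        unfolding W_def by blast
      then show ?thesis unfolding W_def
        by (intro CollectI exI[of _ "c *\<^sub>R x1"] exI[of _ "c *\<^sub>R q"])
           (simp add: rscale_scaleR scaleR_add_right qsubspace_scaleR[OF qs])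
    qed
  qed
  moreover have "realify B - {b \<cdot>\<^sub>q u} \<subseteq> W"
  proof
    fix x assume "x \<in> realify B - {b \<cdot>\<^sub>q u}"
    then obtain b' v where x: "b' \<in> B" "v \<in> quat_units" "x = b' \<cdot>\<^sub>q v" "x \<noteq> b \<cdot>\<^sub>q u"
      by (auto simp: realify_def)
    show "x \<in> W"
    proof (cases "b' = b")
      case True
      then have "inner v u = 0" using x u quat_units_inner by auto
      then show ?thesis using True x qs unfolding W_def qsubspace_def
        by (intro CollectI exI[of _ 0] exI[of _ v]) auto
    next
      case False
      then have "b' \<in> qspan (B - {b})" using x subsetD[OF qspan_superset, of b' "B - {b}"] by simp
      then show ?thesis using x qs unfolding W_def qsubspace_def
        by (intro CollectI exI[of _ x] exI[of _ 0]) auto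
    qed
  qed
  ultimately have "b \<cdot>\<^sub>q u \<in> W" using bu span_minimal by blast
  then obtain y q where y: "y \<in> qspan (B - {b})" "inner q u = 0" "b \<cdot>\<^sub>q u = y + b \<cdot>\<^sub>q q"
    unfolding W_def by blast
  have "inner (u - q) u = 1" using y quat_units_inner[OF u u] by (simp add: inner_diff_left)
  then have "u - q \<noteq> 0" by auto
  moreover have "b \<cdot>\<^sub>q (u - q) \<in> qspan (B - {b})" using y by (simp add: rscale_diff_right)
  ultimately have "b \<in> qspan (B - {b})" using rscale_mem_qsubspace_iff[OF qs] by blast
  then show False using ind B by (simp add: qindependent_def)
qed

text \<open>Both realifications are real bases of the same space, and their cardinalities are four
  times those of \<open>B\<close> and \<open>C\<close>; for infinite sets \<open>card\<close> is 0
  on both sides.\<close>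

lemma qindependent_card_eq:
  fixes B C :: "'a::quaternionic_vector set"
  assumes "qindependent B" "qindependent C" "qspan B = qspan C"
  shows "card B = card C"
proof -
  have "\<exists>f. bij_betw f (realify B) (realify C)"
    by (intro bij_if_span_eq_span_bases independent_realify assms) (simp add: span_realify assms)
  then have "card (realify B) = card (realify C)" by (auto intro: bij_betw_same_card)
  then show ?thesis
    unfolding realify_def by (simp add: card_image inj_on_realify assms card_cartesian_product card_quat_units)
qed

section \<open>Dimension of eigenspaces of diagonal operators\<close>

lemma qindependent_orthonormal:
  assumes "qorthonormal F"
  shows "qindependent F"
  unfolding qindependent_def
proof (intro ballI notI)
  fix x assume x: "x \<in> F" "x \<in> qspan (F - {x})"
  have "qspan (F - {x}) \<subseteq> {y. qinner x y = 0}"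
    using assms x by (intro qspan_minimal)
      (auto simp: qsubspace_def qinner_add_right qinner_rscale_right qorthonormal_def)
  then show False using x assms by (auto simp: qorthonormal_def)
qed

lemma qdim_qspan_orthonormal:
  assumes "qorthonormal F"
  shows "qdim (qspan F) = card F"
proof -
  let ?P = "\<lambda>B. qindependent B \<and> qspan B = qspan F"
  have "?P F" using qindependent_orthonormal[OF assms] by simp
  then have "?P (SOME B. ?P B)" by (rule someI)
  then show ?thesis unfolding qdim_def using qindependent_card_eq qindependent_orthonormal[OF assms] by blast
qed

text \<open>Comparing coefficients in \<open>A x = \<mu> *\<^sub>R x\<close> leaves only those at
  basis vectors with \<open>m e = \<mu>\<close>. As these are finitely many, the expansion of
  \<open>x\<close> is an algebraic combination, as \<open>qspan\<close> demands.\<close>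

lemma eigenspace_eq_qspan:
  assumes E: "qcomplete E" and A: "bounded_qlinear A" and Ae: "\<And>e. e \<in> E \<Longrightarrow> A e = m e *\<^sub>R e"
    and fin: "finite {e \<in> E. m e = \<mu>}"
  shows "{x. A x = x \<cdot>\<^sub>q of_real \<mu>} = qspan {e \<in> E. m e = \<mu>}" (is "?L = qspan ?F")
proof
  have on: "qorthonormal E" using E by (simp add: qcomplete_def)
  have "qsubspace ?L" unfolding qsubspace_def
    by (auto simp: bounded_qlinearD[OF A] rscale_add_left quat_of_real_commute simp flip: rscale_mult)
  moreover have "?F \<subseteq> ?L" using Ae by (auto simp: scaleR_eq_rscale)
  ultimately show "qspan ?F \<subseteq> ?L" by (rule qspan_minimal[rotated])
  show "?L \<subseteq> qspan ?F"
  proof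
    fix x assume "x \<in> ?L"
    then have Ax: "A x = \<mu> *\<^sub>R x" by (simp add: scaleR_eq_rscale)
    have "((\<lambda>e. A (e \<cdot>\<^sub>q qinner e x)) has_sum A x) E"
      by (rule has_sum_bounded_linear[OF bounded_qlinearD(1)[OF A] qcomplete_expansion[OF E]])
    moreover have "A (e \<cdot>\<^sub>q qinner e x) = e \<cdot>\<^sub>q (m e *\<^sub>R qinner e x)" if "e \<in> E" for e
      using Ae[OF that] by (simp add: bounded_qlinearD[OF A] scaleR_rscale rscale_scaleR)
    ultimately have "((\<lambda>e. e \<cdot>\<^sub>q (m e *\<^sub>R qinner e x)) has_sum A x) E"
      by (simp cong: has_sum_cong)
    from orthonormal_has_sum(1)[OF on this] have eq: "(m e - \<mu>) *\<^sub>R qinner e x = 0" if "e \<in> E" for e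
      using that by (simp only: Ax qinner_scaleR_right scaleR_diff_left diff_self)
    have "e \<cdot>\<^sub>q qinner e x = 0" if "e \<in> E - ?F" for e
      using eq[of e] that unfolding scaleR_eq_0_iff by auto
    then have "((\<lambda>e. e \<cdot>\<^sub>q qinner e x) has_sum (\<Sum>e\<in>?F. e \<cdot>\<^sub>q qinner e x)) E"
      by (intro has_sum_finite_neutralI[OF fin]) auto
    then have "x = (\<Sum>e\<in>?F. e \<cdot>\<^sub>q qinner e x)"
      using has_sum_unique qcomplete_expansion[OF E] by blast
    also have "\<dots> \<in> qspan ?F"
    proof -
      have "(\<Sum>e\<in>G. e \<cdot>\<^sub>q qinner e x) \<in> qspan ?F" if "G \<subseteq> ?F" for G
        using finite_subset[OF that fin] that qsubspace_qspan[of ?F] qspan_superset[of ?F]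
        by (induction G rule: finite_induct) (auto simp: qsubspace_def)
      then show ?thesis by blast
    qed
    finally show "x \<in> qspan ?F" .
  qed
qed

lemma eigen_multiplicity_op_abs:
  assumes T: "compact_qlinear T" and E: "right_singular_basis T E" and \<mu>: "\<mu> > 0"
  shows "finite {e \<in> E. norm (T e) = \<mu>}" and "eigen_multiplicity (op_abs T) \<mu> = card {e \<in> E. norm (T e) = \<mu>}"
proof -
  have bq: "bounded_qlinear T" using T by (simp add: compact_qlinear_def)
  have cE: "qcomplete E" and on: "qorthonormal E"
    using E by (auto simp: right_singular_basis_def qcomplete_def)
  note abs = op_abs_right_singular_basis[OF bq E]
  show fin: "finite {e \<in> E. norm (T e) = \<mu>}"
    by (rule finite_subset[OF _ finite_large_norm_right_singular_basis[OF T E \<mu>]]) auto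
  have "bounded_qlinear (op_abs T)" using abs(1) by (simp add: qpositive_def)
  from eigenspace_eq_qspan[OF cE this abs(2) fin]
  have "eigen_multiplicity (op_abs T) \<mu> = qdim (qspan {e \<in> E. norm (T e) = \<mu>})"
    by (simp add: eigen_multiplicity_def)
  also have "\<dots> = card {e \<in> E. norm (T e) = \<mu>}"
    by (intro qdim_qspan_orthonormal qorthonormal_subset[OF on]) auto
  finally show "eigen_multiplicity (op_abs T) \<mu> = card {e \<in> E. norm (T e) = \<mu>}" .
qed

section \<open>Decreasing rearrangements\<close>

text \<open>Bijections between the finite level sets are glued over all positive values. The zero
  level stays out because nothing relates its sizes on the two sides.\<close>

lemma ex_bij_betw_level_sets:
  fixes f :: "'a \<Rightarrow> real" and g :: "'b \<Rightarrow> real"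
  assumes "\<And>\<mu>. \<mu> > 0 \<Longrightarrow> finite {a \<in> A. f a = \<mu>}" "\<And>\<mu>. \<mu> > 0 \<Longrightarrow> finite {b \<in> B. g b = \<mu>}"
    and "\<And>\<mu>. \<mu> > 0 \<Longrightarrow> card {a \<in> A. f a = \<mu>} = card {b \<in> B. g b = \<mu>}"
  shows "\<exists>h. bij_betw h {a \<in> A. f a > 0} {b \<in> B. g b > 0} \<and> (\<forall>a\<in>A. f a > 0 \<longrightarrow> g (h a) = f a)"
proof -
  have "\<exists>h. \<mu> > 0 \<longrightarrow> bij_betw h {a \<in> A. f a = \<mu>} {b \<in> B. g b = \<mu>}" for \<mu>
    using finite_same_card_bij[OF assms] by blast
  then obtain H where H: "\<And>\<mu>. \<mu> > 0 \<Longrightarrow> bij_betw (H \<mu>) {a \<in> A. f a = \<mu>} {b \<in> B. g b = \<mu>}" by metis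
  define h where "h a = H (f a) a" for a
  have h: "h a \<in> B \<and> g (h a) = f a" if "a \<in> A" "f a > 0" for a
    using bij_betwE[OF H[OF that(2)]] that by (auto simp: h_def)
  have "bij_betw h {a \<in> A. f a > 0} {b \<in> B. g b > 0}"
    unfolding bij_betw_def
  proof (intro conjI inj_onI equalityI subsetI)
    fix a a' assume a: "a \<in> {a \<in> A. f a > 0}" "a' \<in> {a \<in> A. f a > 0}" "h a = h a'"
    then have "f a = f a'" using h[of a] h[of a'] by auto
    then show "a = a'" using bij_betw_imp_inj_on[OF H[of "f a"]] a by (auto simp: h_def inj_on_def)
  next
    fix b assume b: "b \<in> {b \<in> B. g b > 0}"
    then have "b \<in> H (g b) ` {a \<in> A. f a = g b}" using bij_betw_imp_surj_on[OF H[of "g b"]] by auto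
    then obtain a where "a \<in> A" "f a = g b" "b = h a" by (auto simp: h_def)
    then show "b \<in> h ` {a \<in> A. f a > 0}" using b by auto
  qed (use h in auto)
  then show ?thesis using h by blast
qed

text \<open>The strict superlevel sets of a decreasing sequence are initial segments, so their sizes determine it.\<close>

lemma decseq_eqI_level_sets:
  fixes s s' :: "nat \<Rightarrow> real" and f :: "'a \<Rightarrow> real"
  assumes fin: "\<And>t. t > 0 \<Longrightarrow> finite {a \<in> A. f a > t}"
    and s: "decseq s" "\<And>n. 0 \<le> s n"
      "\<And>\<mu>. \<mu> > 0 \<Longrightarrow> finite {n. s n = \<mu>}" "\<And>\<mu>. \<mu> > 0 \<Longrightarrow> card {n. s n = \<mu>} = card {a \<in> A. f a = \<mu>}"
    and s': "decseq s'" "\<And>n. 0 \<le> s' n"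
      "\<And>\<mu>. \<mu> > 0 \<Longrightarrow> finite {n. s' n = \<mu>}" "\<And>\<mu>. \<mu> > 0 \<Longrightarrow> card {n. s' n = \<mu>} = card {a \<in> A. f a = \<mu>}"
  shows "s = s'"
proof -
  have fin': "finite {a \<in> A. f a = \<mu>}" if "\<mu> > 0" for \<mu>
    using that by (intro finite_subset[OF _ fin[of "\<mu> / 2"]]) auto
  \<comment> \<open>Indices start at 0, so \<open>s n > t\<close> means that the
    \<open>n + 1\<close> terms up to index \<open>n\<close> all exceed \<open>t\<close>.\<close>
  have less: "s n > t \<longleftrightarrow> n < card {a \<in> A. f a > t}"
    if s: "decseq s" "\<And>\<mu>. \<mu> > 0 \<Longrightarrow> finite {n. s n = \<mu>}"
      "\<And>\<mu>. \<mu> > 0 \<Longrightarrow> card {n. s n = \<mu>} = card {a \<in> A. f a = \<mu>}" and t: "t > 0" for s n t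
  proof -
    obtain h where h: "bij_betw h {n \<in> UNIV. s n > 0} {a \<in> A. f a > 0}" "\<forall>n\<in>UNIV. s n > 0 \<longrightarrow> f (h n) = s n"
      using ex_bij_betw_level_sets[of UNIV s A f] s fin' by auto
    let ?S = "{n. s n > t}" and ?F = "{a \<in> A. f a > t}"
    have "inj_on h ?S" using t by (intro inj_on_subset[OF bij_betw_imp_inj_on[OF h(1)]]) auto
    moreover have "h ` ?S = ?F"
    proof (intro equalityI subsetI)
      fix a assume a: "a \<in> ?F"
      then have "a \<in> h ` {n \<in> UNIV. s n > 0}" using bij_betw_imp_surj_on[OF h(1)] t by auto
      then show "a \<in> h ` ?S" using a h(2) by auto
    qed (use h t bij_betwE[OF h(1)] in auto)
    ultimately have bij: "bij_betw h ?S ?F" by (simp add: bij_betw_def)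
    then have fS: "finite ?S" and cS: "card ?S = card ?F"
      using fin[OF t] bij_betw_finite bij_betw_same_card by blast+
    show ?thesis
    proof
      assume n: "s n > t"
      have "{..n} \<subseteq> ?S" using n decseqD[OF s(1)] by (auto intro: less_le_trans)
      from card_mono[OF fS this] show "n < card ?F" by (simp add: cS)
    next
      assume n: "n < card ?F"
      show "s n > t"
      proof (rule ccontr)
        assume "\<not> s n > t"
        then have "\<not> n \<le> m" if "m \<in> ?S" for m
          using decseqD[OF s(1), of n m] that by auto
        then have "?S \<subseteq> {..<n}" by (auto simp: not_le)
        from card_mono[OF _ this] n show False by (simp add: cS)
      qed
    qed
  qed
  have iff: "s n > t \<longleftrightarrow> s' n > t" if "t > 0" for n t
    using less[OF s(1,3,4) that] less[OF s'(1,3,4) that] by blast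
  show "s = s'"
  proof
    fix n
    \<comment> \<open>If the two values differed, their midpoint would be positive and would
      separate them.\<close>
    show "s n = s' n"
      using iff[of "(s n + s' n) / 2" n] s(2)[of n] s'(2)[of n] by (cases "s n" "s' n" rule: linorder_cases) auto
  qed
qed

text \<open>The term \<open>s n\<close> is the supremum of the levels exceeded by more than
  \<open>n\<close> elements. The work lies in \<open>s_greater\<close>, after which each level set
  of \<open>s\<close> is an interval of indices.\<close>

lemma ex_decreasing_rearrangement:
  fixes f :: "'a \<Rightarrow> real"
  assumes fin: "\<And>t. t > 0 \<Longrightarrow> finite {a \<in> A. f a > t}"
  shows "\<exists>s :: nat \<Rightarrow> real. decseq s \<and> (\<forall>n. 0 \<le> s n) \<and>
     (\<forall>\<mu>>0. finite {n. s n = \<mu>} \<and> card {n. s n = \<mu>} = card {a \<in> A. f a = \<mu>})"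
proof -
  define F where "F t = {a \<in> A. f a > t}" for t
  define N where "N t = card (F t)" for t
  \<comment> \<open>The inserted 0 is the value of \<open>s n\<close> when no positive level is
    exceeded by more than \<open>n\<close> elements.\<close>
  define S where "S n = insert 0 {t. 0 < t \<and> n < N t}" for n
  define s where "s n = Sup (S n)" for n
  have finF: "finite (F t)" if "t > 0" for t using fin[OF that] by (simp add: F_def)
  have N_anti: "N u \<le> N t" if "0 < t" "t \<le> u" for t u
    unfolding N_def using that by (intro card_mono finF) (auto simp: F_def)
  have bdd: "bdd_above (S n)" for n
  proof (rule bdd_aboveI)
    let ?C = "Max (insert 1 (f ` F 1))"
    have C: "finite (insert 1 (f ` F 1))" using finF[of 1] by simp
    fix t assume "t \<in> S n"
    then consider "t = 0" | "t > 0" "F t \<noteq> {}"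
      by (cases "F t = {}") (auto simp: S_def N_def)
    then show "t \<le> ?C"
    proof cases
      case 1 then show ?thesis using Max_ge[OF C, of 1] by simp
    next
      case 2
      then obtain a where a: "a \<in> A" "f a > t" by (auto simp: F_def)
      then have "f a \<le> 1 \<or> f a \<in> f ` F 1" by (auto simp: F_def)
      then have "f a \<le> ?C" using Max_ge[OF C, of 1] Max_ge[OF C, of "f a"] by auto
      with a show ?thesis by simp
    qed
  qed
  have s_greater: "t < s n \<longleftrightarrow> n < N t" if t: "t > 0" for t n
  proof
    assume "t < s n"
    then obtain y where "y \<in> S n" "t < y"
      unfolding s_def by (subst (asm) less_cSup_iff[OF _ bdd]) (auto simp: S_def)
    then show "n < N t" using N_anti[of t y] t by (auto simp: S_def)
  next
    assume n: "n < N t"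
    then have ne: "F t \<noteq> {}" by (auto simp: N_def)
    \<comment> \<open>Raising the level from \<open>t\<close> to a point strictly below the least
      value above \<open>t\<close> loses no element, which gives the strict inequality.\<close>
    define m where "m = Min (f ` F t)"
    have m: "m \<in> f ` F t" unfolding m_def using finF[OF t] ne by (intro Min_in) auto
    then have tm: "t < m" by (auto simp: F_def)
    have "m \<le> f a" if "a \<in> F t" for a unfolding m_def using finF[OF t] that by (intro Min_le) auto
    then have "F t \<subseteq> F ((t + m) / 2)" using tm by (fastforce simp: F_def)
    then have "N t \<le> N ((t + m) / 2)" unfolding N_def using t tm by (intro card_mono finF) auto
    then have "(t + m) / 2 \<in> S n" using n t tm by (auto simp: S_def)
    then have "(t + m) / 2 \<le> s n" unfolding s_def by (rule cSup_upper[OF _ bdd])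
    then show "t < s n" using tm by simp
  qed
  have nonneg: "0 \<le> s n" for n
    unfolding s_def by (rule cSup_upper[OF _ bdd]) (simp add: S_def)
  have "decseq s" unfolding decseq_def
  proof (intro allI impI)
    fix m n :: nat assume mn: "m \<le> n"
    show "s n \<le> s m"
      unfolding s_def using mn by (intro cSup_subset_mono bdd) (auto simp: S_def)
  qed
  moreover have "finite {n. s n = \<mu>} \<and> card {n. s n = \<mu>} = card {a \<in> A. f a = \<mu>}" if \<mu>: "\<mu> > 0" for \<mu>
  proof -
    \<comment> \<open>The largest value of \<open>f\<close> strictly between
      \<open>\<mu> / 2\<close> and \<open>\<mu>\<close>, or \<open>\<mu> / 2\<close> if there is
      none; hence \<open>f\<close> takes no value strictly between \<open>t\<close> and
      \<open>\<mu>\<close>.\<close>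
    define t where "t = Max (insert (\<mu> / 2) (f ` {a \<in> F (\<mu> / 2). f a < \<mu>}))"
    have fin2: "finite (insert (\<mu> / 2) (f ` {a \<in> F (\<mu> / 2). f a < \<mu>}))" using finF[of "\<mu> / 2"] \<mu> by simp
    have "t \<in> insert (\<mu> / 2) (f ` {a \<in> F (\<mu> / 2). f a < \<mu>})" unfolding t_def by (intro Max_in fin2) simp
    then have t: "0 < t" "t < \<mu>" using \<mu> by (auto simp: F_def)
    have gap: "f a \<ge> \<mu>" if a: "a \<in> A" "f a > t" for a
    proof (rule ccontr)
      assume "\<not> f a \<ge> \<mu>"
      moreover have "\<mu> / 2 \<le> t" unfolding t_def by (intro Max_ge fin2) simp
      ultimately have "f a \<in> insert (\<mu> / 2) (f ` {a \<in> F (\<mu> / 2). f a < \<mu>})" using a by (auto simp: F_def)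
      then have "f a \<le> t" unfolding t_def by (intro Max_ge fin2)
      with a show False by simp
    qed
    have "s n = \<mu> \<longleftrightarrow> N \<mu> \<le> n \<and> n < N t" for n
    proof
      assume "s n = \<mu>"
      then show "N \<mu> \<le> n \<and> n < N t" using s_greater[of t n] s_greater[of \<mu> n] t \<mu> by auto
    next
      assume n: "N \<mu> \<le> n \<and> n < N t"
      then have st: "t < s n" "s n \<le> \<mu>" using s_greater[of t n] s_greater[of \<mu> n] t \<mu> by auto
      show "s n = \<mu>"
      proof (rule ccontr)
        assume "s n \<noteq> \<mu>"
        with st have v: "t < s n" "s n < \<mu>" by simp_all
        have "f a > t \<longleftrightarrow> f a > s n" if "a \<in> A" for a
          using gap[OF that] v by linarith
        then have "F t = F (s n)" unfolding F_def by blast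
        then have "n < N (s n)" using n by (simp add: N_def)
        then show False using s_greater[of "s n" n] st t by simp
      qed
    qed
    then have lev: "{n. s n = \<mu>} = {N \<mu>..<N t}"
      by (simp only: set_eq_iff mem_Collect_eq atLeastLessThan_iff simp_thms)
    have "f a = \<mu> \<longleftrightarrow> f a > t \<and> \<not> f a > \<mu>" if "a \<in> A" for a
      using gap[OF that] t by linarith
    then have "{a \<in> A. f a = \<mu>} = F t - F \<mu>" unfolding F_def by blast
    moreover have "F \<mu> \<subseteq> F t" using t by (auto simp: F_def)
    ultimately have "card {a \<in> A. f a = \<mu>} = N t - N \<mu>"
      using finF[OF \<mu>] by (simp add: N_def card_Diff_subset)
    then show ?thesis by (simp add: lev)
  qed
  ultimately show ?thesis using nonneg by blast
qed

text \<open>The multiplicities of \<open>op_abs T\<close> are the sizes of the level sets of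
  \<open>norm (T e)\<close> on \<open>E\<close>. Existence and uniqueness of the decreasing
  rearrangement therefore justify the definite description in \<open>singular_value\<close>.\<close>

lemma singular_value_rearrangement:
  assumes T: "compact_qlinear T" and E: "right_singular_basis T E"
  shows "\<And>n. 0 \<le> singular_value T n"
    and "\<exists>h. bij_betw h {n. singular_value T n > 0} {e \<in> E. norm (T e) > 0} \<and>
             (\<forall>n. singular_value T n > 0 \<longrightarrow> norm (T (h n)) = singular_value T n)"
proof -
  let ?f = "\<lambda>e. norm (T e)"
  note mult = eigen_multiplicity_op_abs[OF T E]
  have fin: "finite {e \<in> E. ?f e > t}" if "t > 0" for t
    by (rule finite_subset[OF _ finite_large_norm_right_singular_basis[OF T E that]]) auto
  let ?P = "\<lambda>s. decseq s \<and> (\<forall>n. 0 \<le> s n) \<and>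
     (\<forall>\<mu>>0. finite {n. s n = \<mu>} \<and> card {n. s n = \<mu>} = eigen_multiplicity (op_abs T) \<mu>)"
  have "\<exists>!s. ?P s"
  proof (rule ex_ex1I)
    show "\<exists>s. ?P s" using ex_decreasing_rearrangement[of E ?f] fin by (simp add: mult)
    show "s = s'" if "?P s" "?P s'" for s s'
      using that by (intro decseq_eqI_level_sets[of E ?f, OF fin]) (auto simp: mult)
  qed
  then have P: "?P (singular_value T)" unfolding singular_value_def by (rule theI')
  then show "0 \<le> singular_value T n" for n by blast
  show "\<exists>h. bij_betw h {n. singular_value T n > 0} {e \<in> E. ?f e > 0} \<and>
             (\<forall>n. singular_value T n > 0 \<longrightarrow> ?f (h n) = singular_value T n)"
    using ex_bij_betw_level_sets[of UNIV "singular_value T" E ?f] P mult by simp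
qed

section \<open>Sums of powers\<close>

lemma has_sum_ennreal:
  assumes "(f has_sum s) A" "\<And>a. 0 \<le> f a"
  shows "((\<lambda>a. ennreal (f a)) has_sum ennreal s) A"
  using tendsto_ennrealI[OF assms(1)[unfolded has_sum_def]] assms(2) by (simp add: has_sum_def flip: sum_ennreal)

lemma summable_on_iff_infsum_ennreal:
  fixes f :: "'a \<Rightarrow> real"
  assumes nn: "\<And>a. 0 \<le> f a"
  shows "f summable_on A \<longleftrightarrow> (\<Sum>\<^sub>\<infinity>a\<in>A. ennreal (f a)) \<noteq> \<infinity>"
proof
  assume "f summable_on A"
  then obtain s where "(f has_sum s) A" by (auto simp: summable_on_def)
  then show "(\<Sum>\<^sub>\<infinity>a\<in>A. ennreal (f a)) \<noteq> \<infinity>" by (simp add: infsumI[OF has_sum_ennreal[of f A s]] nn)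
next
  let ?X = "\<Sum>\<^sub>\<infinity>a\<in>A. ennreal (f a)"
  assume X: "?X \<noteq> \<infinity>"
  have "sum f F \<le> enn2real ?X" if "finite F" "F \<subseteq> A" for F
  proof -
    have "ennreal (sum f F) = (\<Sum>a\<in>F. ennreal (f a))" by (simp add: nn sum_ennreal)
    also have "\<dots> = (\<Sum>\<^sub>\<infinity>a\<in>F. ennreal (f a))" using that by simp
    also have "\<dots> \<le> ?X" using that by (intro infsum_mono_neutral nonneg_summable_on_complete) auto
    also have "\<dots> = ennreal (enn2real ?X)" using X by (simp add: less_top)
    finally show ?thesis by (simp add: ennreal_le_iff)
  qed
  then show "f summable_on A" by (intro nonneg_bdd_above_summable_on nn bdd_aboveI2) auto
qed

lemma suminf_ennreal_eq_infsum:
  fixes f :: "nat \<Rightarrow> ennreal"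
  shows "suminf f = infsum f UNIV"
  using sums_unique[OF has_sum_imp_sums[OF has_sum_infsum[OF nonneg_summable_on_complete, of UNIV f]]] by simp

lemma infsum_singular_value:
  assumes T: "compact_qlinear T" and E: "right_singular_basis T E"
  shows "(\<Sum>n. ennreal (singular_value T n powr p)) = (\<Sum>\<^sub>\<infinity>e\<in>E. ennreal (norm (T e) powr p))"
proof -
  let ?s = "singular_value T"
  obtain h where h: "bij_betw h {n. ?s n > 0} {e \<in> E. norm (T e) > 0}"
    and hs: "\<And>n. ?s n > 0 \<Longrightarrow> norm (T (h n)) = ?s n"
    using singular_value_rearrangement(2)[OF T E] by blast
  have "(\<Sum>n. ennreal (?s n powr p)) = (\<Sum>\<^sub>\<infinity>n. ennreal (?s n powr p))"
    by (rule suminf_ennreal_eq_infsum)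
  \<comment> \<open>Vanishing singular values contribute nothing, since \<open>0 powr p = 0\<close>;
    only the positive ones are matched with basis vectors.\<close>
  also have "\<dots> = (\<Sum>\<^sub>\<infinity>n\<in>{n. ?s n > 0}. ennreal (?s n powr p))"
    using singular_value_rearrangement(1)[OF T E]
    by (intro infsum_cong_neutral) (auto simp: less_le)
  also have "\<dots> = (\<Sum>\<^sub>\<infinity>n\<in>{n. ?s n > 0}. ennreal (norm (T (h n)) powr p))"
    by (intro infsum_cong) (simp add: hs)
  also have "\<dots> = (\<Sum>\<^sub>\<infinity>e\<in>{e \<in> E. norm (T e) > 0}. ennreal (norm (T e) powr p))"
    by (rule infsum_reindex_bij_betw[OF h])
  also have "\<dots> = (\<Sum>\<^sub>\<infinity>e\<in>E. ennreal (norm (T e) powr p))"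
    by (intro infsum_cong_neutral) auto
  finally show ?thesis .
qed

lemma powr_above_tangent:
  fixes t a q :: real
  assumes "q \<ge> 1" "t \<ge> 0" "a \<ge> 0"
  shows "a powr q + q * a powr (q - 1) * (t - a) \<le> t powr q"
proof (cases "a = 0 \<or> t = 0")
  \<comment> \<open>The derivative is available only on the open half-line, so the endpoint is
    treated by hand. For \<open>a = 0\<close> the left side is 0, even for \<open>q = 1\<close>,
    because \<open>0 powr 0 = 0\<close>; for \<open>t = 0\<close> the claim becomes
    \<open>a powr q \<le> q * a powr q\<close>.\<close>
  case True
  then show ?thesis
  proof
    assume "t = 0"
    moreover have "a powr (q - 1) * a = a powr q"
      using assms(3) by (cases "a = 0") (simp_all add: powr_diff)
    moreover have "a powr q \<le> q * a powr q" using assms by (simp add: mult_le_cancel_right1)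
    ultimately show ?thesis by (simp add: mult.assoc)
  qed simp
next
  case False
  then have "t powr q - a powr q \<ge> q * a powr (q - 1) * (t - a)"
    using assms by (intro convex_on_imp_above_tangent[of "{0<..}"] powr_convex)
      (auto simp: interior_open intro!: derivative_eq_intros)
  then show ?thesis by simp
qed

text \<open>Jensen's inequality for the probability weights \<open>|\<langle>e, x\<rangle>|\<^sup>2\<close>, proved by summing the tangent line inequality.\<close>

lemma norm_powr_le_right_singular_basis:
  fixes T :: "'a::quaternionic_hilbert \<Rightarrow> 'a"
  assumes bq: "bounded_qlinear T" and E: "right_singular_basis T E" and p: "2 \<le> p" and x: "norm x = 1"
    and Z: "((\<lambda>e. norm (T e) powr p * (norm (qinner e x))\<^sup>2) has_sum Z) E"
  shows "norm (T x) powr p \<le> Z"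
proof -
  have cE: "qcomplete E" and B: "\<And>e. e \<in> E \<Longrightarrow> qadjoint T (T e) = (norm (T e))\<^sup>2 *\<^sub>R e"
    using E by (auto simp: right_singular_basis_def)
  let ?w = "\<lambda>e. (norm (qinner e x))\<^sup>2" and ?t = "\<lambda>e. (norm (T e))\<^sup>2"
  define q where "q = p / 2"
  define a where "a = (norm (T x))\<^sup>2"
  have sq: "(r\<^sup>2) powr q = r powr p" if "r \<ge> 0" for r :: real
    using that by (cases "r = 0") (simp_all add: q_def powr_powr flip: powr_numeral)
  have w: "(?w has_sum 1) E" using Parseval[OF cE, of x] x by simp
  \<comment> \<open>The mean of the values \<open>?t e\<close> is \<open>a\<close>: expand the
    second \<open>x\<close> in the product of \<open>x\<close> with \<open>T* T x\<close>, which
    equals \<open>(norm (T x))^2\<close>.\<close>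
  have wt: "((\<lambda>e. ?t e * ?w e) has_sum a) E"
  proof -
    have Bq: "bounded_qlinear (\<lambda>x. qadjoint T (T x))"
      using bounded_qlinear_comp[OF bounded_qlinear_qadjoint[OF bq] bq] by (simp add: o_def)
    have bl: "bounded_linear (\<lambda>y. qRe (qinner x (qadjoint T (T y))))"
    proof -
      have "bounded_linear (\<lambda>z. inner z (1::quat))" by (rule bounded_linear_inner_left)
      then have "bounded_linear qRe" by (simp add: inner_quat_def)
      then show ?thesis
        by (rule bounded_linear_compose)
           (rule bounded_linear_compose[OF bounded_linear_qinner_right bounded_qlinearD(1)[OF Bq]])
    qed
    have "((\<lambda>e. qRe (qinner x (qadjoint T (T (e \<cdot>\<^sub>q qinner e x))))) has_sum a) E"
      using has_sum_bounded_linear[OF bl qcomplete_expansion[OF cE, of x]]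
      by (simp add: qinner_qadjoint_right[OF bq] qinner_self a_def)
    moreover have "qRe (qinner x (qadjoint T (T (e \<cdot>\<^sub>q qinner e x)))) = ?t e * ?w e" if "e \<in> E" for e
    proof -
      have "qinner x (qadjoint T (T (e \<cdot>\<^sub>q qinner e x))) = ?t e *\<^sub>R (qcnj (qinner e x) * qinner e x)"
        unfolding bounded_qlinearD(2)[OF Bq] B[OF that] qinner_rscale_right qinner_scaleR_right
          qinner_cnj[of x e] by simp
      then show ?thesis by (simp add: qcnj_mult_self)
    qed
    ultimately show ?thesis by (simp cong: has_sum_cong)
  qed
  let ?d = "q * a powr (q - 1)"
  \<comment> \<open>The tangent line at \<open>a\<close>, averaged with the weights
    \<open>?w\<close>. As \<open>a\<close> is the mean of the \<open>?t e\<close>, the linear part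
    cancels and \<open>a powr q\<close> remains.\<close>
  have "((\<lambda>e. (a powr q - ?d * a) * ?w e + ?d * (?t e * ?w e)) has_sum ((a powr q - ?d * a) * 1 + ?d * a)) E"
    by (intro has_sum_add has_sum_cmult_right w wt)
  then have "(a powr q - ?d * a) * 1 + ?d * a \<le> Z"
  proof (rule has_sum_mono[OF _ Z])
    fix e
    have "(a powr q + ?d * (?t e - a)) * ?w e \<le> ?t e powr q * ?w e"
      using p by (intro mult_right_mono powr_above_tangent) (auto simp: q_def a_def)
    then show "(a powr q - ?d * a) * ?w e + ?d * (?t e * ?w e) \<le> norm (T e) powr p * ?w e"
      by (simp add: sq algebra_simps)
  qed
  then show ?thesis by (simp add: sq a_def)
qed

text \<open>Unless the right side is infinite, it suffices to bound finite subsets \<open>G\<close>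
  of \<open>F\<close>. Jensen is applied to each \<open>f\<close> in \<open>G\<close>, and the
  finite sum is moved inside the sum over \<open>E\<close>.\<close>

lemma orthonormal_infsum_le_right_singular_basis:
  fixes T :: "'a::quaternionic_hilbert \<Rightarrow> 'a"
  assumes bq: "bounded_qlinear T" and E: "right_singular_basis T E" and p: "2 \<le> p" and F: "qorthonormal F"
  shows "(\<Sum>\<^sub>\<infinity>f\<in>F. ennreal (norm (T f) powr p)) \<le> (\<Sum>\<^sub>\<infinity>e\<in>E. ennreal (norm (T e) powr p))"
proof (cases "(\<lambda>e. norm (T e) powr p) summable_on E")
  case False
  then show ?thesis using summable_on_iff_infsum_ennreal[of "\<lambda>e. norm (T e) powr p" E] by simp
next
  case True
  have on: "qorthonormal E" using E by (simp add: right_singular_basis_def qcomplete_def)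
  obtain S where S: "((\<lambda>e. norm (T e) powr p) has_sum S) E" using True by (auto simp: summable_on_def)
  have bound: "(\<Sum>f\<in>G. norm (T f) powr p) \<le> S" if G: "finite G" "G \<subseteq> F" for G
  proof -
    let ?a = "\<lambda>f e. norm (T e) powr p * (norm (qinner e f))\<^sup>2"
    \<comment> \<open>Bessel with the roles exchanged: \<open>e\<close> is expanded along the
      orthonormal set \<open>F\<close>, so the total weight that \<open>e\<close> receives is at
      most 1.\<close>
    have col: "(\<Sum>f\<in>G. (norm (qinner e f))\<^sup>2) \<le> 1" if "e \<in> E" for e
    proof -
      have "(\<Sum>f\<in>G. (norm (qinner e f))\<^sup>2) = (\<Sum>f\<in>G. (norm (qinner f e))\<^sup>2)"
        by (intro sum.cong refl) (metis qinner_cnj norm_qcnj)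
      also have "\<dots> \<le> (norm e)\<^sup>2" by (rule Bessel_finite[OF F G])
      finally show ?thesis by (simp add: qorthonormal_norm[OF on that])
    qed
    have "\<exists>Z. (?a f has_sum Z) E" if "f \<in> G" for f
    proof -
      have "?a f e \<le> norm (T e) powr p" if "e \<in> E" for e
      proof -
        have "(norm (qinner e f))\<^sup>2 \<le> (\<Sum>f\<in>G. (norm (qinner e f))\<^sup>2)"
          using \<open>f \<in> G\<close> G(1) by (intro member_le_sum) auto
        with col[OF that] show ?thesis by (intro mult_left_le) auto
      qed
      then have "?a f summable_on E" by (intro summable_on_comparison_test[OF True]) auto
      then show ?thesis by (simp add: summable_on_def)
    qed
    then obtain Z where Z: "\<And>f. f \<in> G \<Longrightarrow> (?a f has_sum Z f) E" by metis
    have "(\<Sum>f\<in>G. norm (T f) powr p) \<le> (\<Sum>f\<in>G. Z f)"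
      using G by (intro sum_mono norm_powr_le_right_singular_basis[OF bq E p _ Z] qorthonormal_norm[OF F]) auto
    also have "\<dots> \<le> S"
    proof (rule has_sum_mono[OF _ S])
      show "((\<lambda>e. \<Sum>f\<in>G. ?a f e) has_sum (\<Sum>f\<in>G. Z f)) E"
        using G(1) Z by (induction G rule: finite_induct) (auto intro: has_sum_add)
      show "(\<Sum>f\<in>G. ?a f e) \<le> norm (T e) powr p" if "e \<in> E" for e
        using col[OF that] by (simp add: mult_left_le flip: sum_distrib_left)
    qed
    finally show ?thesis .
  qed
  have "(\<Sum>\<^sub>\<infinity>f\<in>F. ennreal (norm (T f) powr p)) \<le> ennreal S"
    using bound by (intro infsum_le_finite_sums nonneg_summable_on_complete) (simp_all add: sum_ennreal ennreal_leI)
  also have "ennreal S = (\<Sum>\<^sub>\<infinity>e\<in>E. ennreal (norm (T e) powr p))"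
    using infsumI[OF has_sum_ennreal[OF S]] by simp
  finally show ?thesis .
qed

section \<open>The Schatten norm as a supremum over the slice\<close>

lemma ennpowr_mono: "x \<le> y \<Longrightarrow> 0 \<le> a \<Longrightarrow> ennpowr x a \<le> ennpowr y a"
  by (auto simp: ennpowr_def top_unique less_top intro!: ennreal_leI powr_mono2 enn2real_mono)

theorem theorem3p29:
  fixes T J :: "'a::quaternionic_hilbert \<Rightarrow> 'a" and i :: quat and p :: real
  assumes separable: "separable_space (euclidean :: 'a topology)"
    and J_bounded: "bounded_qlinear J"
    and J_anti: "anti_selfadjoint J"
    and J_unitary: "qunitary J"
    and i_unit: "i \<in> imaginary_units"
    and T_compact: "compact_qlinear T"
    and T_commutes: "commutator T J = (\<lambda>x. 0)"
    and p_ge: "2 \<le> p"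
  shows "(T \<in> schatten_class p J \<longleftrightarrow>
            (\<forall>E. qorthonormal E \<and> E \<subseteq> plus_slice J i \<longrightarrow>
                 (\<lambda>e. norm (T e) powr p) summable_on E))
       \<and> schatten_norm p T =
            (SUP E \<in> {E. qorthonormal E \<and> E \<subseteq> plus_slice J i}.
               ennpowr (\<Sum>\<^sub>\<infinity>e\<in>E. ennreal (norm (T e) powr p)) (1 / p))"
proof -
  have bq: "bounded_qlinear T" using T_compact by (simp add: compact_qlinear_def)
  obtain B where B: "right_singular_basis T B" "B \<subseteq> plus_slice J i"
    using ex_right_singular_basis_in_plus_slice[OF J_bounded J_anti J_unitary i_unit T_compact T_commutes]
    by blast
  then have onB: "qorthonormal B" by (simp add: right_singular_basis_def qcomplete_def)
  let ?X = "\<lambda>E. \<Sum>\<^sub>\<infinity>e\<in>E. ennreal (norm (T e) powr p)"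
  have le: "?X E \<le> ?X B" if "qorthonormal E" for E
    by (rule orthonormal_infsum_le_right_singular_basis[OF bq B(1) p_ge that])
  have sv: "(\<Sum>n. ennreal (singular_value T n powr p)) = ?X B"
    by (rule infsum_singular_value[OF T_compact B(1)])
  have sum_iff: "(\<lambda>e. norm (T e) powr p) summable_on E \<longleftrightarrow> ?X E \<noteq> \<infinity>" for E
    by (rule summable_on_iff_infsum_ennreal) simp
  have "T \<in> schatten_class p J \<longleftrightarrow> (\<lambda>n. singular_value T n powr p) summable_on UNIV"
    by (simp add: schatten_class_def T_compact T_commutes summable_on_UNIV_nonneg_real_iff)
  also have "\<dots> \<longleftrightarrow> ?X B \<noteq> \<infinity>"
    unfolding sv[symmetric] suminf_ennreal_eq_infsum by (rule summable_on_iff_infsum_ennreal) simp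
  also have "\<dots> \<longleftrightarrow> (\<forall>E. qorthonormal E \<and> E \<subseteq> plus_slice J i \<longrightarrow> ?X E \<noteq> \<infinity>)"
    using le onB B(2) by (metis infinity_ennreal_def top_unique)
  finally have "T \<in> schatten_class p J \<longleftrightarrow>
      (\<forall>E. qorthonormal E \<and> E \<subseteq> plus_slice J i \<longrightarrow> (\<lambda>e. norm (T e) powr p) summable_on E)"
    by (simp only: sum_iff)
  moreover have "schatten_norm p T =
      (SUP E \<in> {E. qorthonormal E \<and> E \<subseteq> plus_slice J i}. ennpowr (?X E) (1 / p))"
    unfolding schatten_norm_def sv
  proof (rule antisym)
    show "ennpowr (?X B) (1 / p) \<le>
        (SUP E \<in> {E. qorthonormal E \<and> E \<subseteq> plus_slice J i}. ennpowr (?X E) (1 / p))"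
      using onB B(2) by (intro SUP_upper) simp
    show "(SUP E \<in> {E. qorthonormal E \<and> E \<subseteq> plus_slice J i}. ennpowr (?X E) (1 / p)) \<le>
        ennpowr (?X B) (1 / p)"
      using p_ge le by (intro SUP_least ennpowr_mono) auto
  qed
  ultimately show ?thesis by blast
qed

end
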